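(* Let $M$ be a compact $C^\infty$ submanifold of $\mathbb{R}^N$ with the Riemannian structure inherited from $\mathbb{R}^N$, let $M\times M$ carry the product metric, and let $\alpha>0$. Let $U_\alpha$ denote the unique minimizer of the problem $$\begin{array}{rl}\text{Minimize}_U & \frac{\alpha}{2}\int_{M\times M}\left(|\nabla_1 U(x,y)|^2+|\nabla_2 U(x,y)|^2\right)d\mathrm{Vol}(x,y)-\int_{M\times M}U(x,y)\,d\mathrm{Vol}(x,y)\\ \text{subject to} & U\in W^{1,2}(M\times M),\\ & |\nabla_1U(x,y)|\le1\ \text{ in } \{(x,y)\mid x\ne y\},\\ & |\nabla_2U(x,y)|\le1\ \text{ in } \{(x,y)\mid x\ne y\},\\ & U(x,y)\le0\ \text{ on } \{(x,y)\mid x=y\}.\end{array}$$ Then the function $U_\alpha(x,y)$ is symmetric in $x$ and $y$, i.e. $U_\alpha(x,y)=U_\alpha(y,x)$.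
   Context: For $U:M\times M\to\mathbb{R}$, $\nabla_1U(x,y)$ denotes the gradient in $M$ of $x\mapsto U(x,y)$ (with $y$ fixed) and $\nabla_2U(x,y)$ the gradient in $M$ of $y\mapsto U(x,y)$ (with $x$ fixed), so that $\nabla_{M\times M}U=(\nabla_1U,\nabla_2U)$ under $T_{(x,y)}(M\times M)=T_xM\oplus T_yM$. $W^{1,2}(M\times M)$ is the Sobolev space of functions in $L^2(M\times M)$ whose distributional gradient is in $L^2$, and $d\mathrm{Vol}$ is the Riemannian volume measure of the product metric. The paper asserts in a companion theorem that the minimizer exists and is unique. *)

theory Defs
  imports "HOL-Analysis.Analysis" "HOL-Combinatorics.Permutations"
begin

section \<open>Smooth maps and submanifolds of Euclidean space\<close>

text \<open>Meant for open \<open>D\<close>: all directional derivatives of order below \<open>n\<close> exist and are Frechet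
  differentiable, those of order \<open>n\<close> are continuous.\<close>

primrec times_differentiable_on ::
  "nat \<Rightarrow> 'a::real_normed_vector set \<Rightarrow> ('a \<Rightarrow> 'b::real_normed_vector) \<Rightarrow> bool" where
  "times_differentiable_on 0 D f \<longleftrightarrow> continuous_on D f"
| "times_differentiable_on (Suc n) D f \<longleftrightarrow>
     (\<forall>x\<in>D. f differentiable (at x)) \<and>
     (\<forall>v. times_differentiable_on n D (\<lambda>x. frechet_derivative f (at x) v))"

definition smooth_on ::
  "'a::real_normed_vector set \<Rightarrow> ('a \<Rightarrow> 'b::real_normed_vector) \<Rightarrow> bool" where
  "smooth_on D f \<longleftrightarrow> (\<forall>n. times_differentiable_on n D f)"

text \<open>A slice chart, read from the model space to the manifold: \<open>\<Phi>\<close> is a diffeomorphism between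
  open sets of the ambient space taking a coordinate plane \<open>span B\<close> of dimension \<open>d\<close> to \<open>S\<close>.
  Its restriction to \<open>span B\<close> is a local parametrization of \<open>S\<close>.  Coordinate planes
  (rather than a type of dimension \<open>d\<close>) serve as the model of $\mathbb{R}^d$ so that \<open>d\<close> is an
  ordinary natural number, possibly \<open>0\<close>.\<close>

definition slice_chart ::
  "nat \<Rightarrow> 'a::euclidean_space set \<Rightarrow> 'a set \<Rightarrow> 'a set \<Rightarrow> ('a \<Rightarrow> 'a) \<Rightarrow> bool" where
  "slice_chart d S B W \<Phi> \<longleftrightarrow>
     B \<subseteq> Basis \<and> card B = d \<and>
     open W \<and> inj_on \<Phi> W \<and> open (\<Phi> ` W) \<and>
     smooth_on W \<Phi> \<and> smooth_on (\<Phi> ` W) (inv_into W \<Phi>) \<and>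
     \<Phi> ` (W \<inter> span B) = \<Phi> ` W \<inter> S"

definition smooth_submanifold :: "nat \<Rightarrow> 'a::euclidean_space set \<Rightarrow> bool" where
  "smooth_submanifold d S \<longleftrightarrow> (\<forall>p\<in>S. \<exists>B W \<Phi>. slice_chart d S B W \<Phi> \<and> p \<in> \<Phi> ` W)"

definition tangent_space :: "'a::euclidean_space set \<Rightarrow> 'a \<Rightarrow> 'a set" where
  "tangent_space S p =
     {v. \<exists>\<gamma>::real \<Rightarrow> 'a. \<exists>e>0. smooth_on {-e<..<e} \<gamma> \<and> \<gamma> ` {-e<..<e} \<subseteq> S \<and>
           \<gamma> 0 = p \<and> (\<gamma> has_vector_derivative v) (at 0)}"


section \<open>Riemannian volume\<close>

text \<open>Every submanifold \<open>S\<close> carries the metric induced by the ambient inner product.  For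
  \<open>S = M \<times> M\<close> inside \<open>'a \<times> 'a\<close> this is the product metric, since the inner product of the product
  type is the sum of the inner products of the components.\<close>

definition det_on :: "'i set \<Rightarrow> ('i \<Rightarrow> 'i \<Rightarrow> real) \<Rightarrow> real" where
  "det_on B A = (\<Sum>\<pi> | \<pi> permutes B. of_int (sign \<pi>) * (\<Prod>i\<in>B. A i (\<pi> i)))"

definition volume_density :: "'a::euclidean_space set \<Rightarrow> ('a \<Rightarrow> 'a) \<Rightarrow> 'a \<Rightarrow> real" where
  "volume_density B \<Phi> z =
     sqrt (det_on B (\<lambda>i j. frechet_derivative \<Phi> (at z) i \<bullet> frechet_derivative \<Phi> (at z) j))"

text \<open>Lebesgue measure of the coordinate plane \<open>span B\<close>, as a measure on the ambient space;
  the case \<open>B = Basis\<close> is \<open>lborel\<close>, the case \<open>B = {}\<close> is the unit mass at \<open>0\<close>.\<close>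

definition plane_lborel :: "'a::euclidean_space set \<Rightarrow> 'a measure" where
  "plane_lborel B = distr (\<Pi>\<^sub>M b\<in>B. lborel) borel (\<lambda>c. \<Sum>b\<in>B. c b *\<^sub>R b)"

text \<open>The Riemannian volume is characterized as the Borel measure on \<open>S\<close> given in every chart by
  $\sqrt{\det (g_{ij})}\,dz$.\<close>

definition riemannian_volume :: "nat \<Rightarrow> 'a::euclidean_space set \<Rightarrow> 'a measure \<Rightarrow> bool" where
  "riemannian_volume d S \<mu> \<longleftrightarrow>
     space \<mu> = S \<and> sets \<mu> = sets (restrict_space borel S) \<and>
     (\<forall>B W \<Phi>. slice_chart d S B W \<Phi> \<longrightarrow>
        (\<forall>A\<in>sets \<mu>. A \<subseteq> \<Phi> ` W \<longrightarrow>
           emeasure \<mu> A =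
             (\<integral>\<^sup>+z. ennreal (volume_density B \<Phi> z) * indicator {z \<in> W. \<Phi> z \<in> A} z \<partial>plane_lborel B)))"


section \<open>Weak gradients\<close>

definition square_integrable :: "'a measure \<Rightarrow> ('a \<Rightarrow> 'b::euclidean_space) \<Rightarrow> bool" where
  "square_integrable \<mu> f \<longleftrightarrow> f \<in> borel_measurable \<mu> \<and> integrable \<mu> (\<lambda>p. (norm (f p))\<^sup>2)"

definition smooth_tangent_field :: "'a::euclidean_space set \<Rightarrow> ('a \<Rightarrow> 'a) \<Rightarrow> bool" where
  "smooth_tangent_field S X \<longleftrightarrow>
     (\<exists>D. open D \<and> S \<subseteq> D \<and> smooth_on D X) \<and> (\<forall>p\<in>S. X p \<in> tangent_space S p)"

text \<open>The Levi-Civita connection of the induced metric is $\nabla_v X = P (DX\,v)$, where \<open>P\<close> is the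
  orthogonal projection to the tangent space.  The divergence is the trace of
  $v \mapsto \nabla_v X$ on the tangent space, that is the sum over \<open>b\<close> of $P (DX (P b)) \cdot b$.\<close>

definition surface_divergence :: "'a::euclidean_space set \<Rightarrow> ('a \<Rightarrow> 'a) \<Rightarrow> 'a \<Rightarrow> real" where
  "surface_divergence S X p =
     (let P = closest_point (tangent_space S p)
      in \<Sum>b\<in>Basis. P (frechet_derivative X (at p) (P b)) \<bullet> b)"

text \<open>\<open>S\<close> is meant to be compact without boundary, so test fields need no support condition.
  A weak gradient is determined up to null sets.\<close>

definition weak_gradient ::
  "'a::euclidean_space set \<Rightarrow> 'a measure \<Rightarrow> ('a \<Rightarrow> real) \<Rightarrow> ('a \<Rightarrow> 'a) \<Rightarrow> bool" where
  "weak_gradient S \<mu> U F \<longleftrightarrow>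
     (AE p in \<mu>. F p \<in> tangent_space S p) \<and>
     (\<forall>X. smooth_tangent_field S X \<longrightarrow>
        (\<integral>p. F p \<bullet> X p \<partial>\<mu>) = - (\<integral>p. U p * surface_divergence S X p \<partial>\<mu>))"

text \<open>\<open>U\<close> belongs to $W^{1,2}(S)$ and has distributional gradient \<open>F\<close>.\<close>

definition sobolev12 ::
  "'a::euclidean_space set \<Rightarrow> 'a measure \<Rightarrow> ('a \<Rightarrow> real) \<Rightarrow> ('a \<Rightarrow> 'a) \<Rightarrow> bool" where
  "sobolev12 S \<mu> U F \<longleftrightarrow>
     square_integrable \<mu> U \<and> square_integrable \<mu> F \<and> weak_gradient S \<mu> U F"

definition continuous_representative ::
  "'a::euclidean_space set \<Rightarrow> 'a measure \<Rightarrow> ('a \<Rightarrow> real) \<Rightarrow> ('a \<Rightarrow> real) \<Rightarrow> bool" where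
  "continuous_representative S \<mu> U V \<longleftrightarrow> continuous_on S V \<and> (AE p in \<mu>. V p = U p)"


section \<open>The minimization problem\<close>

text \<open>The measure \<open>\<mu>\<close> is the Riemannian volume of \<open>M \<times> M\<close>.  The components of the gradient \<open>F\<close> in
  \<open>'a \<times> 'a\<close> are $\nabla_1 U$ and $\nabla_2 U$.  The diagonal is in general a null set; the
  constraint on it refers to the continuous representative, which exists because \<open>U\<close> has a bounded
  weak gradient.\<close>

definition feasible ::
  "'a::euclidean_space set \<Rightarrow> ('a \<times> 'a) measure \<Rightarrow> ('a \<times> 'a \<Rightarrow> real) \<Rightarrow> ('a \<times> 'a \<Rightarrow> 'a \<times> 'a) \<Rightarrow> bool"
  where
  "feasible M \<mu> U F \<longleftrightarrow>
     sobolev12 (M \<times> M) \<mu> U F \<and>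
     (AE (x, y) in \<mu>. x \<noteq> y \<longrightarrow> norm (fst (F (x, y))) \<le> 1) \<and>
     (AE (x, y) in \<mu>. x \<noteq> y \<longrightarrow> norm (snd (F (x, y))) \<le> 1) \<and>
     (\<exists>V. continuous_representative (M \<times> M) \<mu> U V \<and> (\<forall>x\<in>M. V (x, x) \<le> 0))"

definition objective ::
  "real \<Rightarrow> ('a::euclidean_space \<times> 'a) measure \<Rightarrow> ('a \<times> 'a \<Rightarrow> real) \<Rightarrow> ('a \<times> 'a \<Rightarrow> 'a \<times> 'a) \<Rightarrow> real"
  where
  "objective \<alpha> \<mu> U F =
     \<alpha> / 2 * (\<integral>(x, y). (norm (fst (F (x, y))))\<^sup>2 + (norm (snd (F (x, y))))\<^sup>2 \<partial>\<mu>)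
     - (\<integral>(x, y). U (x, y) \<partial>\<mu>)"

definition minimizer ::
  "real \<Rightarrow> 'a::euclidean_space set \<Rightarrow> ('a \<times> 'a) measure \<Rightarrow> ('a \<times> 'a \<Rightarrow> real) \<Rightarrow> bool" where
  "minimizer \<alpha> M \<mu> U \<longleftrightarrow>
     (\<exists>F. feasible M \<mu> U F \<and>
        (\<forall>V G. feasible M \<mu> V G \<longrightarrow> objective \<alpha> \<mu> U F \<le> objective \<alpha> \<mu> V G))"

text \<open>Uniqueness is as an element of $W^{1,2}(M \times M)$, so up to null sets.\<close>

definition unique_minimizer ::
  "real \<Rightarrow> 'a::euclidean_space set \<Rightarrow> ('a \<times> 'a) measure \<Rightarrow> ('a \<times> 'a \<Rightarrow> real) \<Rightarrow> bool" where
  "unique_minimizer \<alpha> M \<mu> U \<longleftrightarrow>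
     minimizer \<alpha> M \<mu> U \<and> (\<forall>V. minimizer \<alpha> M \<mu> V \<longrightarrow> (AE p in \<mu>. V p = U p))"

end

theory Submission
  imports Defs "Jordan_Normal_Form.Determinant"
begin

no_notation scalar_prod (infix "\<bullet>" 70)

text \<open>The exchange \<open>\<sigma>\<close> of the two factors is an isometry of \<open>M \<times> M\<close>. It preserves the volume, since
  composing a chart with \<open>\<sigma>\<close> gives a chart with the same parameter domain and the same density; it
  carries weak gradients to weak gradients, and it exchanges the two gradient constraints.
  Hence \<open>U \<circ> \<sigma>\<close> is again a minimizer, and uniqueness gives \<open>U \<circ> \<sigma> = U\<close> almost everywhere.
  Nonempty open subsets of \<open>M \<times> M\<close> have positive volume because Gram determinants of independent
  vectors are positive, so for the continuous representative the equality holds everywhere.\<close>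

section \<open>Calculus of smooth maps\<close>

text \<open>The form of the definitions decides where the work lies. Smoothness is a recursion
  through \<open>frechet_derivative\<close>, and formulas for derivatives are known only at points
  of the domain; so each closure property is an induction on the order, with functions exchanged
  along agreement on an open set. Tangent vectors are velocities of curves; that they form a
  subspace, so that \<open>closest_point\<close> in the divergence is a genuine projection
  compatible with \<sigma>, is read off from charts. The volume is prescribed only for sets inside a
  single chart image, so its invariance is checked chart by chart and assembled over a countable
  cover. Positivity of the volume is hidden in \<open>det_on\<close>, a bare sum over permutations,
  and is brought out by a homotopy of positive definite matrices.\<close>

lemma times_differentiable_on_cong:
  assumes "open D" "\<And>x. x \<in> D \<Longrightarrow> f x = g x" "times_differentiable_on n D f"
  shows "times_differentiable_on n D g"
  using assms(2,3)
proof (induction n arbitrary: f g)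
  case 0
  then show ?case by (auto intro: continuous_on_eq)
next
  case (Suc n)
  have diff: "f differentiable at x" if "x \<in> D" for x
    using Suc.prems that by simp
  have "g differentiable at x" if "x \<in> D" for x
    using has_derivative_transform_within_open[OF _ assms(1) that, of f _ UNIV g]
      diff[OF that] Suc.prems(1) unfolding differentiable_def by metis
  moreover have "times_differentiable_on n D (\<lambda>x. frechet_derivative g (at x) v)" for v
  proof (rule Suc.IH)
    show "times_differentiable_on n D (\<lambda>x. frechet_derivative f (at x) v)"
      using Suc.prems by simp
    show "frechet_derivative f (at x) v = frechet_derivative g (at x) v" if "x \<in> D" for x
      using frechet_derivative_transform_within_open[OF diff[OF that] assms(1) that Suc.prems(1)]
      by simp
  qed
  ultimately show ?case by simp
qed

lemma times_differentiable_on_subset: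
  "times_differentiable_on n D f \<Longrightarrow> E \<subseteq> D \<Longrightarrow> times_differentiable_on n E f"
  by (induction n arbitrary: f) (auto intro: continuous_on_subset)

text \<open>A directional derivative of the composite is \<open>h\<close> of a directional
  derivative of \<open>f\<close>, so the claim reproduces itself one order lower. The identity holds
  on \<open>D\<close> only, which is where openness and the congruence lemma enter.\<close>

lemma times_differentiable_on_bounded_linear:
  assumes "bounded_linear h" "open D" "times_differentiable_on n D f"
  shows "times_differentiable_on n D (\<lambda>x. h (f x))"
  using assms(3)
proof (induction n arbitrary: f)
  case 0
  then show ?case
    using bounded_linear.continuous_on[OF assms(1)] by auto
next
  case (Suc n)
  have der: "((\<lambda>x. h (f x)) has_derivative (\<lambda>v. h (frechet_derivative f (at x) v))) (at x)"
    if "x \<in> D" for x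
    using that Suc.prems
    by (intro bounded_linear.has_derivative[OF assms(1)]) (simp add: frechet_derivative_works)
  have "times_differentiable_on n D (\<lambda>x. frechet_derivative (\<lambda>x. h (f x)) (at x) v)" for v
    by (rule times_differentiable_on_cong[OF assms(2) _ Suc.IH, of "\<lambda>x. frechet_derivative f (at x) v"])
      (use Suc.prems frechet_derivative_at[OF der] in \<open>auto dest: fun_cong\<close>)
  then show ?case
    using der by (auto simp: differentiable_def)
qed

text \<open>The derivative in direction \<open>v\<close> is the derivative of \<open>f\<close> in
  the fixed direction \<open>L v\<close> at the moved point, again of the form treated. With
  \<open>a = 0\<close> this serves composition with \<sigma>; with \<open>L\<close> defined on the
  reals it serves straight lines.\<close>

lemma times_differentiable_on_affine:
  assumes "bounded_linear L" "open D" "times_differentiable_on n D f"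
  shows "times_differentiable_on n ((\<lambda>x. a + L x) -` D) (\<lambda>x. f (a + L x))"
  using assms(3)
proof (induction n arbitrary: f)
  case 0
  have "continuous_on ((\<lambda>x. a + L x) -` D) (\<lambda>x. a + L x)"
    by (intro continuous_intros linear_continuous_on assms)
  then show ?case
    using 0 continuous_on_compose2[of D f _ "\<lambda>x. a + L x"] by auto
next
  case (Suc n)
  have der: "((\<lambda>x. f (a + L x)) has_derivative (\<lambda>v. frechet_derivative f (at (a + L x)) (L v))) (at x)"
    if "a + L x \<in> D" for x
  proof (rule has_derivative_compose[of "\<lambda>x. a + L x"])
    show "((\<lambda>x. a + L x) has_derivative L) (at x)"
      using bounded_linear_imp_has_derivative[OF assms(1)] by (auto intro!: derivative_eq_intros)
    show "(f has_derivative frechet_derivative f (at (a + L x))) (at (a + L x))"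
      using that Suc.prems by (simp add: frechet_derivative_works)
  qed
  have "continuous_on UNIV (\<lambda>x. a + L x)"
    by (intro continuous_intros linear_continuous_on assms)
  then have open_vimage: "open ((\<lambda>x. a + L x) -` D)"
    using assms(2) by (simp add: open_vimage)
  have "times_differentiable_on n ((\<lambda>x. a + L x) -` D)
      (\<lambda>x. frechet_derivative (\<lambda>x. f (a + L x)) (at x) v)" for v
    by (rule times_differentiable_on_cong[OF open_vimage _ Suc.IH,
          of "\<lambda>x. frechet_derivative f (at x) (L v)"])
      (use Suc.prems frechet_derivative_at[OF der] in \<open>auto dest: fun_cong\<close>)
  then show ?case
    using der by (auto simp: differentiable_def)
qed

lemma has_derivative_map_prod:
  assumes "(f has_derivative f') (at (fst p))" "(g has_derivative g') (at (snd p))"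
  shows "(map_prod f g has_derivative map_prod f' g') (at p)"
proof -
  have "((\<lambda>p. (f (fst p), g (snd p))) has_derivative (\<lambda>v. (f' (fst v), g' (snd v)))) (at p)"
    by (intro has_derivative_Pair has_derivative_compose[of fst fst p UNIV f f']
        has_derivative_compose[of snd snd p UNIV g g'] has_derivative_fst has_derivative_snd
        has_derivative_ident assms)
  then show ?thesis
    by (simp add: map_prod_def case_prod_unfold)
qed

text \<open>The derivative in direction \<open>v\<close> is again a \<open>map_prod\<close>, of the
  derivatives in the directions \<open>fst v\<close> and \<open>snd v\<close>, so the induction
  closes. Product charts are maps of this form.\<close>

lemma times_differentiable_on_map_prod:
  assumes "open D" "open E" "times_differentiable_on n D f" "times_differentiable_on n E g"
  shows "times_differentiable_on n (D \<times> E) (map_prod f g)"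
  using assms(3,4)
proof (induction n arbitrary: f g)
  case 0
  then have "continuous_on (D \<times> E) (\<lambda>p. (f (fst p), g (snd p)))"
    by (intro continuous_on_Pair continuous_on_compose2[of D f _ fst]
        continuous_on_compose2[of E g _ snd] continuous_intros) auto
  then show ?case
    by (simp add: map_prod_def case_prod_unfold)
next
  case (Suc n)
  have der: "(map_prod f g has_derivative
      map_prod (frechet_derivative f (at (fst p))) (frechet_derivative g (at (snd p)))) (at p)"
    if "p \<in> D \<times> E" for p
    using that Suc.prems
    by (intro has_derivative_map_prod) (auto simp: frechet_derivative_works[symmetric])
  have "times_differentiable_on n (D \<times> E) (\<lambda>p. frechet_derivative (map_prod f g) (at p) v)" for v
    by (rule times_differentiable_on_cong[OF open_Times[OF assms(1,2)] _ Suc.IH,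
          of "\<lambda>x. frechet_derivative f (at x) (fst v)" "\<lambda>x. frechet_derivative g (at x) (snd v)"])
      (use Suc.prems frechet_derivative_at[OF der] in \<open>auto simp: map_prod_def case_prod_unfold dest: fun_cong\<close>)
  then show ?case
    using der unfolding times_differentiable_on.simps differentiable_def by blast
qed

section \<open>Passage from finite order to smooth maps\<close>

lemma smooth_on_cong:
  "open D \<Longrightarrow> (\<And>x. x \<in> D \<Longrightarrow> f x = g x) \<Longrightarrow> smooth_on D f \<Longrightarrow> smooth_on D g"
  unfolding smooth_on_def using times_differentiable_on_cong by metis

lemma smooth_on_subset: "smooth_on D f \<Longrightarrow> E \<subseteq> D \<Longrightarrow> smooth_on E f"
  unfolding smooth_on_def using times_differentiable_on_subset by metis

lemma smooth_on_bounded_linear: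
  "bounded_linear h \<Longrightarrow> open D \<Longrightarrow> smooth_on D f \<Longrightarrow> smooth_on D (\<lambda>x. h (f x))"
  unfolding smooth_on_def using times_differentiable_on_bounded_linear by metis

lemma smooth_on_affine:
  "bounded_linear L \<Longrightarrow> open D \<Longrightarrow> smooth_on D f \<Longrightarrow>
    smooth_on ((\<lambda>x. a + L x) -` D) (\<lambda>x. f (a + L x))"
  unfolding smooth_on_def using times_differentiable_on_affine by metis

lemma smooth_on_map_prod:
  "open D \<Longrightarrow> open E \<Longrightarrow> smooth_on D f \<Longrightarrow> smooth_on E g \<Longrightarrow> smooth_on (D \<times> E) (map_prod f g)"
  unfolding smooth_on_def using times_differentiable_on_map_prod by metis

lemma smooth_on_imp_differentiable: "smooth_on D f \<Longrightarrow> x \<in> D \<Longrightarrow> f differentiable (at x)"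
  unfolding smooth_on_def using times_differentiable_on.simps(2)[of 0] by fastforce

lemma smooth_on_imp_has_derivative:
  "smooth_on D f \<Longrightarrow> x \<in> D \<Longrightarrow> (f has_derivative frechet_derivative f (at x)) (at x)"
  using smooth_on_imp_differentiable frechet_derivative_works by blast

lemma smooth_on_imp_continuous_on: "smooth_on D f \<Longrightarrow> continuous_on D f"
  unfolding smooth_on_def using times_differentiable_on.simps(1) by blast

lemma smooth_on_imp_continuous_derivative:
  "smooth_on D f \<Longrightarrow> continuous_on D (\<lambda>x. frechet_derivative f (at x) v)"
  unfolding smooth_on_def using times_differentiable_on.simps(2)[of 0] by fastforce

section \<open>Slice charts\<close>

text \<open>Identifies the parameter plane of a product chart: \<open>Basis\<close> of a product
  type consists of the two embedded bases, so coordinate planes multiply.\<close>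

lemma span_image_Pair_Un:
  "span ((\<lambda>b. (b, 0)) ` B \<union> (\<lambda>b. (0, b)) ` C) = span B \<times> span C"
proof -
  have 1: "span ((\<lambda>b. (b, 0)) ` B) = (\<lambda>b. (b, 0)) ` span B"
    by (rule linear_span_image) (simp add: linear_iff)
  have 2: "span ((\<lambda>b. (0, b)) ` C) = (\<lambda>b. (0, b)) ` span C"
    by (rule linear_span_image) (simp add: linear_iff)
  show ?thesis
  proof
    show "span ((\<lambda>b. (b, 0)) ` B \<union> (\<lambda>b. (0, b)) ` C) \<subseteq> span B \<times> span C"
      unfolding span_Un 1 2 by auto
    show "span B \<times> span C \<subseteq> span ((\<lambda>b. (b, 0)) ` B \<union> (\<lambda>b. (0, b)) ` C)"
    proof safe
      fix a b assume "a \<in> span B" "b \<in> span C"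
      then have "(a, 0) + (0, b) \<in> span ((\<lambda>b. (b, 0)) ` B \<union> (\<lambda>b. (0, b)) ` C)"
        unfolding span_Un 1 2 by blast
      then show "(a, b) \<in> span ((\<lambda>b. (b, 0)) ` B \<union> (\<lambda>b. (0, b)) ` C)" by simp
    qed
  qed
qed

lemma slice_chart_Times:
  fixes S :: "'a::euclidean_space set" and T :: "'b::euclidean_space set"
  assumes "slice_chart d S B W \<Phi>" "slice_chart e T C V \<Psi>"
  shows "slice_chart (d + e) (S \<times> T) ((\<lambda>b. (b, 0)) ` B \<union> (\<lambda>b. (0, b)) ` C) (W \<times> V) (map_prod \<Phi> \<Psi>)"
proof -
  note * = assms[unfolded slice_chart_def]
  have B: "B \<subseteq> Basis" "C \<subseteq> Basis" using * by auto
  have fin: "finite B" "finite C" using B finite_subset finite_Basis by metis+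
  have "(\<lambda>b. (b, 0)) ` B \<union> (\<lambda>b. (0, b)) ` C \<subseteq> (Basis :: ('a \<times> 'b) set)"
    using B by (auto simp: Basis_prod_def)
  moreover have "card ((\<lambda>b. (b, 0::'b)) ` B \<union> (\<lambda>b. (0::'a, b)) ` C) = d + e"
  proof (subst card_Un_disjoint)
    show "(\<lambda>b. (b, 0::'b)) ` B \<inter> (\<lambda>b. (0::'a, b)) ` C = {}"
      using B nonzero_Basis[of 0] by auto
  qed (use fin * in \<open>simp_all add: card_image inj_on_def\<close>)
  moreover have image: "map_prod \<Phi> \<Psi> ` (W \<times> V) = \<Phi> ` W \<times> \<Psi> ` V"
    by (auto simp: image_iff)
  moreover have inj: "inj_on (map_prod \<Phi> \<Psi>) (W \<times> V)"
    using * by (auto simp: inj_on_def)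
  \<comment> \<open>The inverse is the product of the two inverses only on the image, since
    \<open>inv_into\<close> is unspecified elsewhere; the image is open, so this agreement
    suffices.\<close>
  moreover have "smooth_on (\<Phi> ` W \<times> \<Psi> ` V) (inv_into (W \<times> V) (map_prod \<Phi> \<Psi>))"
  proof (rule smooth_on_cong)
    show "smooth_on (\<Phi> ` W \<times> \<Psi> ` V) (map_prod (inv_into W \<Phi>) (inv_into V \<Psi>))"
      using * by (intro smooth_on_map_prod) auto
    fix p assume "p \<in> \<Phi> ` W \<times> \<Psi> ` V"
    then obtain x y where "x \<in> W" "y \<in> V" "p = (\<Phi> x, \<Psi> y)" by auto
    then show "map_prod (inv_into W \<Phi>) (inv_into V \<Psi>) p = inv_into (W \<times> V) (map_prod \<Phi> \<Psi>) p"
      using * inv_into_f_f[OF inj, of "(x, y)"] by (simp add: inv_into_f_f)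
  qed (use * in \<open>auto intro: open_Times\<close>)
  moreover have "map_prod \<Phi> \<Psi> ` ((W \<times> V) \<inter> (span B \<times> span C)) = (\<Phi> ` W \<times> \<Psi> ` V) \<inter> (S \<times> T)"
  proof -
    have "(W \<times> V) \<inter> (span B \<times> span C) = (W \<inter> span B) \<times> (V \<inter> span C)" by auto
    then have "map_prod \<Phi> \<Psi> ` ((W \<times> V) \<inter> (span B \<times> span C)) = (\<Phi> ` (W \<inter> span B)) \<times> (\<Psi> ` (V \<inter> span C))"
      by (auto simp: image_iff)
    then show ?thesis using * by auto
  qed
  moreover have "open (W \<times> V)" "open (\<Phi> ` W \<times> \<Psi> ` V)"
    using * by (auto intro: open_Times)
  moreover have "smooth_on (W \<times> V) (map_prod \<Phi> \<Psi>)"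
    using * by (intro smooth_on_map_prod) auto
  ultimately show ?thesis
    unfolding slice_chart_def span_image_Pair_Un image by (intro conjI)
qed

lemma smooth_submanifold_Times:
  assumes "smooth_submanifold d S" "smooth_submanifold e T"
  shows "smooth_submanifold (d + e) (S \<times> T)"
  unfolding smooth_submanifold_def
proof (intro ballI)
  fix p assume "p \<in> S \<times> T"
  then obtain x y where p: "p = (x, y)" "x \<in> S" "y \<in> T" by auto
  obtain B W \<Phi> where "slice_chart d S B W \<Phi>" "x \<in> \<Phi> ` W"
    using assms(1) p by (auto simp: smooth_submanifold_def)
  moreover obtain C V \<Psi> where "slice_chart e T C V \<Psi>" "y \<in> \<Psi> ` V"
    using assms(2) p by (auto simp: smooth_submanifold_def)
  ultimately show "\<exists>B W \<Phi>. slice_chart (d + e) (S \<times> T) B W \<Phi> \<and> p \<in> \<Phi> ` W"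
    using slice_chart_Times[of d S B W \<Phi> e T C V \<Psi>] p
    by (intro exI conjI) auto
qed

text \<open>Differentiate \<open>inv_into W \<Phi> (\<Phi> x) = x\<close>, valid on the open set
  \<open>W\<close>. The resulting left inverse makes the derivative of a chart injective, hence its
  Gram determinant positive.\<close>

lemma slice_chart_inverse_derivative:
  assumes "slice_chart d S B W \<Phi>" "z \<in> W"
  shows "frechet_derivative (inv_into W \<Phi>) (at (\<Phi> z)) (frechet_derivative \<Phi> (at z) v) = v"
proof -
  note * = assms(1)[unfolded slice_chart_def]
  have "((\<lambda>x. inv_into W \<Phi> (\<Phi> x)) has_derivative
      (\<lambda>v. frechet_derivative (inv_into W \<Phi>) (at (\<Phi> z)) (frechet_derivative \<Phi> (at z) v))) (at z)"
    using * assms(2)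
    by (intro has_derivative_compose[OF smooth_on_imp_has_derivative[of W] smooth_on_imp_has_derivative]) auto
  then have "((\<lambda>x. x) has_derivative
      (\<lambda>v. frechet_derivative (inv_into W \<Phi>) (at (\<Phi> z)) (frechet_derivative \<Phi> (at z) v))) (at z)"
    by (rule has_derivative_transform_within_open[of _ _ _ UNIV W]) (use * assms(2) in \<open>auto simp: inv_into_f_f\<close>)
  then show ?thesis
    by (rule fun_cong[OF has_derivative_unique[OF _ has_derivative_ident]])
qed

lemma slice_chart_parametrized:
  assumes "slice_chart d S B W \<Phi>" "p \<in> S" "p \<in> \<Phi> ` W"
  obtains z where "z \<in> W" "z \<in> span B" "p = \<Phi> z"
  using assms unfolding slice_chart_def by blast

section \<open>Tangent spaces\<close>

text \<open>Turns the description by curves into a linear image: straight lines in the slice give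
  one inclusion, pulling a curve back through the chart gives the other.\<close>

lemma tangent_space_slice_chart:
  assumes chart: "slice_chart d S B W \<Phi>" and z: "z \<in> W" "z \<in> span B"
  shows "tangent_space S (\<Phi> z) = frechet_derivative \<Phi> (at z) ` span B"
proof
  note * = chart[unfolded slice_chart_def]
  let ?D = "frechet_derivative \<Phi> (at z)"
  have D: "(\<Phi> has_derivative ?D) (at z)"
    using * z by (auto intro: smooth_on_imp_has_derivative)
  show "?D ` span B \<subseteq> tangent_space S (\<Phi> z)"
  proof safe
    fix v assume v: "v \<in> span B"
    \<comment> \<open>This line stays in \<open>span B\<close>, and for small \<open>t\<close> in
      the open set \<open>W\<close>, so \<Phi> maps it to a curve in \<open>S\<close> with velocity
      \<open>?D v\<close>.\<close>
    let ?L = "\<lambda>t::real. z + t *\<^sub>R v"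
    have L: "bounded_linear (\<lambda>t::real. t *\<^sub>R v)" by (rule bounded_linear_scaleR_left)
    have "open (?L -` W)"
      using * by (intro open_vimage continuous_intros) auto
    moreover have "0 \<in> ?L -` W" using z by simp
    ultimately obtain e where e: "e > 0" "ball 0 e \<subseteq> ?L -` W"
      using open_contains_ball by metis
    then have sub: "{-e<..<e} \<subseteq> ?L -` W"
      by (auto simp: ball_eq_greaterThanLessThan subset_iff)
    have "smooth_on {-e<..<e} (\<lambda>t. \<Phi> (?L t))"
      using smooth_on_subset[OF smooth_on_affine[OF L] sub] * by auto
    moreover have "(\<lambda>t. \<Phi> (?L t)) ` {-e<..<e} \<subseteq> S"
    proof safe
      fix t :: real assume "t \<in> {-e<..<e}"
      then have "?L t \<in> W \<inter> span B"
        using sub z v by (auto intro: span_add span_scale)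
      then show "\<Phi> (?L t) \<in> S" using * by blast
    qed
    moreover have "((\<lambda>t. \<Phi> (?L t)) has_vector_derivative ?D v) (at 0)"
    proof -
      have "(?L has_derivative (\<lambda>t. t *\<^sub>R v)) (at 0)"
        by (auto intro!: derivative_eq_intros)
      from has_derivative_compose[OF this, of \<Phi> ?D]
      have "((\<lambda>t. \<Phi> (?L t)) has_derivative (\<lambda>t. ?D (t *\<^sub>R v))) (at 0)"
        using D by simp
      then show ?thesis
        unfolding has_vector_derivative_def
        using linear_scale[OF has_derivative_linear[OF D]] by simp
    qed
    ultimately show "?D v \<in> tangent_space S (\<Phi> z)"
      unfolding tangent_space_def using e(1) by (intro CollectI exI[of _ "\<lambda>t. \<Phi> (?L t)"] exI[of _ e]) auto
  qed
  show "tangent_space S (\<Phi> z) \<subseteq> ?D ` span B"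
  proof
    fix v assume "v \<in> tangent_space S (\<Phi> z)"
    then obtain \<gamma> :: "real \<Rightarrow> 'a" and e where \<gamma>: "e > 0" "smooth_on {-e<..<e} \<gamma>" "\<gamma> ` {-e<..<e} \<subseteq> S"
      "\<gamma> 0 = \<Phi> z" "(\<gamma> has_vector_derivative v) (at 0)"
      unfolding tangent_space_def by blast
    \<comment> \<open>The curve pulled back to the model space. \<open>inv_into\<close> inverts
      \<Phi> only over the chart image, so its properties are claimed only near 0, where \<gamma>
      stays in that image.\<close>
    let ?I = "inv_into W \<Phi>" and ?\<eta> = "\<lambda>t. inv_into W \<Phi> (\<gamma> t)"
    have "isCont \<gamma> 0"
      using \<gamma>(5) has_vector_derivative_continuous by blast
    then have "(\<gamma> \<longlongrightarrow> \<gamma> 0) (nhds 0)"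
      by (simp only: isCont_def tendsto_at_iff_tendsto_nhds)
    then have "eventually (\<lambda>t. \<gamma> t \<in> \<Phi> ` W) (nhds 0)"
      using * z \<gamma>(4) by (intro topological_tendstoD) auto
    moreover have "eventually (\<lambda>t. t \<in> {-e<..<e}) (nhds 0)"
      using \<gamma>(1) by (intro eventually_nhds_in_open) auto
    ultimately have "eventually (\<lambda>t. \<gamma> t \<in> \<Phi> ` W \<inter> S) (nhds 0)"
      by eventually_elim (use \<gamma>(3) in blast)
    then have "eventually (\<lambda>t. ?\<eta> t \<in> span B \<and> \<Phi> (?\<eta> t) = \<gamma> t) (nhds 0)"
    proof eventually_elim
      fix t assume "\<gamma> t \<in> \<Phi> ` W \<inter> S"
      then obtain w where "w \<in> W" "w \<in> span B" "\<gamma> t = \<Phi> w" using * by blast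
      then show "?\<eta> t \<in> span B \<and> \<Phi> (?\<eta> t) = \<gamma> t" using * by (simp add: inv_into_f_f)
    qed
    then obtain T where T: "open T" "0 \<in> T" "\<And>t. t \<in> T \<Longrightarrow> ?\<eta> t \<in> span B"
      "\<And>t. t \<in> T \<Longrightarrow> \<Phi> (?\<eta> t) = \<gamma> t"
      unfolding eventually_nhds by blast
    \<comment> \<open>By the chain rule this is the velocity of the pulled-back curve, hence the
      candidate preimage of \<open>v\<close>.\<close>
    define w where "w = frechet_derivative ?I (at (\<Phi> z)) v"
    have I: "(?I has_derivative frechet_derivative ?I (at (\<Phi> z))) (at (\<Phi> z))"
      using * z by (auto intro: smooth_on_imp_has_derivative)
    have "(\<gamma> has_derivative (\<lambda>t. t *\<^sub>R v)) (at 0)"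
      using \<gamma>(5) by (simp add: has_vector_derivative_def)
    from has_derivative_compose[OF this, of ?I "frechet_derivative ?I (at (\<Phi> z))"]
    have \<eta>: "(?\<eta> has_derivative (\<lambda>t. t *\<^sub>R w)) (at 0)"
      using I \<gamma>(4) linear_scale[OF has_derivative_linear[OF I]] by (simp add: w_def)
    \<comment> \<open>Near 0 the pulled-back curve lies in \<open>span B\<close>; its coordinates
      outside \<open>B\<close> vanish there, and so do their derivatives.\<close>
    have "w \<bullet> b = 0" if "b \<in> Basis" "b \<notin> B" for b
    proof -
      have "((\<lambda>t. ?\<eta> t \<bullet> b) has_derivative (\<lambda>t. (t *\<^sub>R w) \<bullet> b)) (at 0)"
        by (rule has_derivative_inner_left[OF \<eta>])
      then have "((\<lambda>t::real. 0::real) has_derivative (\<lambda>t. (t *\<^sub>R w) \<bullet> b)) (at 0)"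
        by (rule has_derivative_transform_within_open[OF _ T(1,2)])
          (use T(3) * that in \<open>auto simp: span_substd_basis\<close>)
      then have "(\<lambda>t. (t *\<^sub>R w) \<bullet> b) = (\<lambda>t. 0)"
        by (rule has_derivative_unique) simp
      from fun_cong[OF this, of 1] show ?thesis by simp
    qed
    then have w: "w \<in> span B"
      using * by (simp add: span_substd_basis)
    have "?\<eta> 0 = z" using \<gamma>(4) * z by (simp add: inv_into_f_f)
    with has_derivative_compose[OF \<eta>, of \<Phi> ?D] D
    have "((\<lambda>t. \<Phi> (?\<eta> t)) has_derivative (\<lambda>t. ?D (t *\<^sub>R w))) (at 0)" by simp
    then have "(\<gamma> has_derivative (\<lambda>t. ?D (t *\<^sub>R w))) (at 0)"
      by (rule has_derivative_transform_within_open[OF _ T(1,2)]) (use T(4) in auto)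
    then have "(\<lambda>t. ?D (t *\<^sub>R w)) = (\<lambda>t. t *\<^sub>R v)"
      by (rule has_derivative_unique) (use \<gamma>(5) in \<open>simp add: has_vector_derivative_def\<close>)
    from fun_cong[OF this, of 1] have "?D w = v" by simp
    then show "v \<in> ?D ` span B" using w by blast
  qed
qed

text \<open>Makes the tangent space closed, convex and nonempty, so that
  \<open>closest_point\<close> attains a unique nearest point.\<close>

lemma subspace_tangent_space:
  assumes "smooth_submanifold d S" "p \<in> S"
  shows "subspace (tangent_space S p)"
proof -
  obtain B W \<Phi> where chart: "slice_chart d S B W \<Phi>" "p \<in> \<Phi> ` W"
    using assms by (auto simp: smooth_submanifold_def)
  with assms(2) obtain z where z: "z \<in> W" "z \<in> span B" "p = \<Phi> z"
    by (meson slice_chart_parametrized)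
  have "linear (frechet_derivative \<Phi> (at z))"
    using chart(1) z smooth_on_imp_has_derivative has_derivative_linear
    unfolding slice_chart_def by metis
  then show ?thesis
    using tangent_space_slice_chart[OF chart(1) z(1,2)] z(3)
    by (simp add: linear_subspace_image)
qed

section \<open>Coordinate involutions\<close>

text \<open>Isolates what the exchange of factors contributes: orthogonality preserves Gram matrices
  and projections, the permutation of \<open>Basis\<close> preserves traces written as sums over
  \<open>Basis\<close>, and involutivity turns images into preimages.\<close>

locale coordinate_involution =
  fixes \<sigma> :: "'a::euclidean_space \<Rightarrow> 'a"
  assumes orthogonal: "orthogonal_transformation \<sigma>"
    and image_Basis: "\<sigma> ` Basis = Basis"
    and involutive [simp]: "\<sigma> (\<sigma> x) = x"
begin

lemma linear: "linear \<sigma>"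
  using orthogonal by (rule orthogonal_transformation_linear)

lemma bounded_linear: "bounded_linear \<sigma>"
  using linear by (simp add: linear_conv_bounded_linear)

lemma inner_eq [simp]: "\<sigma> v \<bullet> \<sigma> w = v \<bullet> w"
  using orthogonal by (simp add: orthogonal_transformation_def)

lemma inner_swap: "\<sigma> v \<bullet> w = v \<bullet> \<sigma> w"
  using inner_eq[of v "\<sigma> w"] by simp

lemma norm_eq [simp]: "norm (\<sigma> v) = norm v"
  by (simp add: norm_eq_sqrt_inner)

lemma dist_eq [simp]: "dist (\<sigma> v) (\<sigma> w) = dist v w"
  using norm_eq[of "v - w"] by (simp add: dist_norm linear_diff[OF linear])

lemma mem_image_iff: "x \<in> \<sigma> ` A \<longleftrightarrow> \<sigma> x \<in> A"
  using imageI[of "\<sigma> x" A \<sigma>] by auto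

lemma image_eq_vimage: "\<sigma> ` A = \<sigma> -` A"
  by (auto simp: mem_image_iff)

lemma open_image: "open A \<Longrightarrow> open (\<sigma> ` A)"
  unfolding image_eq_vimage
  by (rule open_vimage) (auto intro: linear_continuous_on bounded_linear)

lemma has_derivative_conj:
  assumes "(f has_derivative f') (at (\<sigma> x))"
  shows "((\<lambda>x. \<sigma> (f (\<sigma> x))) has_derivative (\<lambda>v. \<sigma> (f' (\<sigma> v)))) (at x)"
proof -
  have "(\<sigma> has_derivative \<sigma>) (at x)"
    by (rule bounded_linear_imp_has_derivative[OF bounded_linear])
  from bounded_linear.has_derivative[OF bounded_linear has_derivative_compose[OF this assms]]
  show ?thesis .
qed

lemma smooth_on_comp: "open D \<Longrightarrow> smooth_on D f \<Longrightarrow> smooth_on (\<sigma> ` D) (\<lambda>x. f (\<sigma> x))"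
  using smooth_on_affine[OF bounded_linear, of D f 0] by (simp add: image_eq_vimage)

lemma slice_chart_comp:
  assumes "slice_chart d S B W \<Phi>" "\<sigma> ` S = S"
  shows "slice_chart d S B W (\<lambda>z. \<sigma> (\<Phi> z))"
proof -
  have B: "B \<subseteq> Basis" "card B = d" and W: "open W" and inj_\<Phi>: "inj_on \<Phi> W"
    and open_\<Phi>: "open (\<Phi> ` W)"
    and smooth_\<Phi>: "smooth_on W \<Phi>" "smooth_on (\<Phi> ` W) (inv_into W \<Phi>)"
    and slice: "\<Phi> ` (W \<inter> span B) = \<Phi> ` W \<inter> S"
    using assms(1) unfolding slice_chart_def by simp_all
  have inj_\<sigma>: "inj_on \<sigma> A" for A
    by (rule inj_on_inverseI[where g = \<sigma>]) simp
  have inj: "inj_on (\<lambda>z. \<sigma> (\<Phi> z)) W"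
    using comp_inj_on[OF inj_\<Phi> inj_\<sigma>] by (simp add: comp_def)
  have image: "(\<lambda>z. \<sigma> (\<Phi> z)) ` A = \<sigma> ` \<Phi> ` A" for A
    by (simp add: image_image)
  have open_\<sigma>\<Phi>: "open (\<sigma> ` \<Phi> ` W)"
    using open_\<Phi> by (rule open_image)
  have "smooth_on (\<sigma> ` \<Phi> ` W) (inv_into W (\<lambda>z. \<sigma> (\<Phi> z)))"
  proof (rule smooth_on_cong[OF open_\<sigma>\<Phi>])
    show "smooth_on (\<sigma> ` \<Phi> ` W) (\<lambda>x. inv_into W \<Phi> (\<sigma> x))"
      by (rule smooth_on_comp[OF open_\<Phi> smooth_\<Phi>(2)])
    fix x assume "x \<in> \<sigma> ` \<Phi> ` W"
    then obtain z where z: "z \<in> W" "x = \<sigma> (\<Phi> z)" by blast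
    show "inv_into W \<Phi> (\<sigma> x) = inv_into W (\<lambda>z. \<sigma> (\<Phi> z)) x"
      using inv_into_f_f[OF inj z(1)] inv_into_f_f[OF inj_\<Phi> z(1)] z(2) by simp
  qed
  moreover have "\<sigma> ` \<Phi> ` (W \<inter> span B) = \<sigma> ` \<Phi> ` W \<inter> S"
    using image_Int[OF inj_\<sigma>, of "\<Phi> ` W" S] slice assms(2) by simp
  moreover have "smooth_on W (\<lambda>z. \<sigma> (\<Phi> z))"
    by (rule smooth_on_bounded_linear[OF bounded_linear W smooth_\<Phi>(1)])
  ultimately show ?thesis
    unfolding slice_chart_def image using B W inj open_\<sigma>\<Phi> by (intro conjI)
qed

text \<open>Both maps have the same Gram matrix, because \<sigma> preserves inner products of the
  partial derivatives.\<close>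

lemma volume_density_comp:
  assumes "\<Phi> differentiable (at z)"
  shows "volume_density B (\<lambda>z. \<sigma> (\<Phi> z)) z = volume_density B \<Phi> z"
proof -
  have "((\<lambda>z. \<sigma> (\<Phi> z)) has_derivative (\<lambda>v. \<sigma> (frechet_derivative \<Phi> (at z) v))) (at z)"
    by (rule bounded_linear.has_derivative[OF bounded_linear assms[unfolded frechet_derivative_works]])
  from frechet_derivative_at[OF this, symmetric] show ?thesis
    by (simp add: volume_density_def)
qed

text \<open>A curve through \<open>p\<close> is mapped to a curve through \<open>\<sigma> p\<close>.
  This inclusion, used at \<open>p\<close> and at \<open>\<sigma> p\<close>, gives both directions
  because \<sigma> is its own inverse.\<close>

lemma tangent_space_image:
  assumes "\<sigma> ` S = S"
  shows "tangent_space S (\<sigma> p) = \<sigma> ` tangent_space S p"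
proof -
  have sub: "\<sigma> v \<in> tangent_space S (\<sigma> p)" if v: "v \<in> tangent_space S p" for v p
  proof -
    from v obtain \<gamma> :: "real \<Rightarrow> 'a" and e where \<gamma>: "e > 0" "smooth_on {-e<..<e} \<gamma>" "\<gamma> ` {-e<..<e} \<subseteq> S"
      "\<gamma> 0 = p" "(\<gamma> has_vector_derivative v) (at 0)"
      unfolding tangent_space_def by blast
    have "smooth_on {-e<..<e} (\<lambda>t. \<sigma> (\<gamma> t))"
      by (rule smooth_on_bounded_linear[OF bounded_linear open_greaterThanLessThan \<gamma>(2)])
    moreover have "(\<lambda>t. \<sigma> (\<gamma> t)) ` {-e<..<e} \<subseteq> S"
      using image_mono[OF \<gamma>(3), of \<sigma>] assms by (simp add: image_image)
    moreover have "((\<lambda>t. \<sigma> (\<gamma> t)) has_vector_derivative \<sigma> v) (at 0)"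
      by (rule bounded_linear.has_vector_derivative[OF bounded_linear \<gamma>(5)])
    ultimately show ?thesis
      unfolding tangent_space_def using \<gamma>(1,4)
      by (intro CollectI exI[of _ "\<lambda>t. \<sigma> (\<gamma> t)"] exI[of _ e]) auto
  qed
  show ?thesis
    using sub[of _ p] sub[of _ "\<sigma> p"] by (auto simp: mem_image_iff)
qed

text \<open>An isometry carries a distance minimizer to a distance minimizer, and the minimizer in a
  closed convex set is unique. Thus tangential projections at \<open>p\<close> and
  \<open>\<sigma> p\<close> are conjugate.\<close>

lemma closest_point_image:
  assumes "closed T" "convex T" "T \<noteq> {}"
  shows "closest_point (\<sigma> ` T) v = \<sigma> (closest_point T (\<sigma> v))"
proof (rule closest_point_unique[symmetric])
  show "convex (\<sigma> ` T)" using linear assms(2) by (rule convex_linear_image)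
  show "closed (\<sigma> ` T)"
    unfolding image_eq_vimage using assms(1)
    by (intro closed_vimage) (auto intro: linear_continuous_on bounded_linear)
  show "\<sigma> (closest_point T (\<sigma> v)) \<in> \<sigma> ` T"
    using closest_point_in_set[OF assms(1,3)] by blast
  show "\<forall>z\<in>\<sigma> ` T. dist v (\<sigma> (closest_point T (\<sigma> v))) \<le> dist v z"
  proof
    fix z assume "z \<in> \<sigma> ` T"
    then have "dist (\<sigma> v) (closest_point T (\<sigma> v)) \<le> dist (\<sigma> v) (\<sigma> z)"
      using closest_point_le[OF assms(1)] by (auto simp: mem_image_iff simp del: dist_eq)
    then show "dist v (\<sigma> (closest_point T (\<sigma> v))) \<le> dist v z"
      using dist_eq[of "\<sigma> v" "closest_point T (\<sigma> v)"] by simp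
  qed
qed

text \<open>This is the push-forward of \<open>X\<close> by \<sigma>; it provides the test field for
  the transformed weak gradient.\<close>

lemma smooth_tangent_field_conj:
  assumes "\<sigma> ` S = S" "smooth_tangent_field S X"
  shows "smooth_tangent_field S (\<lambda>p. \<sigma> (X (\<sigma> p)))"
proof -
  obtain D where D: "open D" "S \<subseteq> D" "smooth_on D X" and X: "\<And>p. p \<in> S \<Longrightarrow> X p \<in> tangent_space S p"
    using assms(2) unfolding smooth_tangent_field_def by auto
  have "open (\<sigma> ` D)"
    using D(1) by (rule open_image)
  moreover have "S \<subseteq> \<sigma> ` D"
    using image_mono[OF D(2), of \<sigma>] assms(1) by simp
  moreover have "smooth_on (\<sigma> ` D) (\<lambda>p. \<sigma> (X (\<sigma> p)))"
    by (rule smooth_on_bounded_linear[OF bounded_linear open_image[OF D(1)] smooth_on_comp[OF D(1,3)]])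
  moreover have "\<sigma> (X (\<sigma> p)) \<in> tangent_space S p" if "p \<in> S" for p
  proof -
    have "\<sigma> p \<in> S" using that assms(1) by blast
    then have "\<sigma> (X (\<sigma> p)) \<in> \<sigma> ` tangent_space S (\<sigma> p)" by (intro imageI X)
    then show ?thesis by (simp flip: tangent_space_image[OF assms(1)])
  qed
  ultimately show ?thesis
    unfolding smooth_tangent_field_def by (intro conjI exI[of _ "\<sigma> ` D"]) auto
qed

text \<open>Projection and derivative are both conjugated by \<sigma>, so the inner copies of
  \<sigma> cancel. One remaining copy acts on the argument and one moves across the inner product,
  leaving the same trace in a permuted basis.\<close>

lemma surface_divergence_conj:
  assumes "\<sigma> ` S = S" "smooth_submanifold d S" "smooth_tangent_field S X" "p \<in> S"
  shows "surface_divergence S (\<lambda>p. \<sigma> (X (\<sigma> p))) p = surface_divergence S X (\<sigma> p)"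
proof -
  let ?T = "tangent_space S p" and ?D = "frechet_derivative X (at (\<sigma> p))"
  have \<sigma>p: "\<sigma> p \<in> S" using assms(1,4) by blast
  have sub: "subspace (tangent_space S (\<sigma> p))"
    using assms(2) \<sigma>p by (rule subspace_tangent_space)
  have T: "?T = \<sigma> ` tangent_space S (\<sigma> p)"
    using tangent_space_image[OF assms(1), of "\<sigma> p"] by simp
  have P: "closest_point ?T v = \<sigma> (closest_point (tangent_space S (\<sigma> p)) (\<sigma> v))" for v
    unfolding T using sub subspace_0 by (intro closest_point_image closed_subspace subspace_imp_convex) auto
  obtain E where "S \<subseteq> E" "smooth_on E X"
    using assms(3) unfolding smooth_tangent_field_def by auto
  then have "(X has_derivative ?D) (at (\<sigma> p))"
    using smooth_on_imp_has_derivative \<sigma>p subsetD by metis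
  from frechet_derivative_at[OF has_derivative_conj[OF this], symmetric]
  have D: "frechet_derivative (\<lambda>p. \<sigma> (X (\<sigma> p))) (at p) v = \<sigma> (?D (\<sigma> v))" for v by simp
  let ?Q = "closest_point (tangent_space S (\<sigma> p))"
  have "surface_divergence S (\<lambda>p. \<sigma> (X (\<sigma> p))) p = (\<Sum>b\<in>Basis. ?Q (?D (?Q (\<sigma> b))) \<bullet> \<sigma> b)"
    unfolding surface_divergence_def Let_def P D by (simp add: inner_swap)
  also have "\<dots> = (\<Sum>b\<in>Basis. ?Q (?D (?Q b)) \<bullet> b)"
  proof (rule sum.reindex_bij_betw)
    show "bij_betw \<sigma> Basis Basis"
      using image_Basis unfolding bij_betw_def inj_on_def by (metis involutive)
  qed
  finally show ?thesis
    by (simp add: surface_divergence_def Let_def)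
qed

end

section \<open>Positivity of the Riemannian volume\<close>

text \<open>Transport along \<open>h\<close> is a sign-preserving bijection between the permutations
  of the index sets. It lets a determinant indexed by basis vectors be read as one indexed by
  \<open>{0..<n}\<close>, as for matrices.\<close>

lemma det_on_reindex:
  assumes "bij_betw h A B" "finite A"
  shows "det_on B G = det_on A (\<lambda>i j. G (h i) (h j))"
proof -
  have inj: "inj_on h A" and B: "B = h ` A" using assms(1) by (auto simp: bij_betw_def)
  have bij: "bij_betw (map_permutation A h) {p. p permutes A} {p. p permutes B}"
  proof (rule bij_betw_byWitness[where f' = "map_permutation B (inv_into A h)"])
    show "\<forall>p\<in>{p. p permutes A}. map_permutation B (inv_into A h) (map_permutation A h p) = p"
      using inj by (auto intro!: map_permutation_compose_inv[OF assms(1)] simp: inv_into_f_f)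
    show "\<forall>p\<in>{p. p permutes B}. map_permutation A h (map_permutation B (inv_into A h) p) = p"
      using assms(1) by (auto intro!: map_permutation_compose_inv[OF bij_betw_inv_into[OF assms(1)]]
          simp: bij_betw_inv_into_right)
    show "map_permutation A h ` {p. p permutes A} \<subseteq> {p. p permutes B}"
      using map_permutation_permutes[OF assms(1)] by auto
    show "map_permutation B (inv_into A h) ` {p. p permutes B} \<subseteq> {p. p permutes A}"
      using map_permutation_permutes[OF bij_betw_inv_into[OF assms(1)]] by auto
  qed
  have "(\<Prod>i\<in>B. G i (map_permutation A h p i)) = (\<Prod>i\<in>A. G (h i) (h (p i)))" if "p permutes A" for p
    unfolding B using inj that
    by (subst prod.reindex) (auto intro!: prod.cong simp: map_permutation_apply)
  then show ?thesis
    unfolding det_on_def sum.reindex_bij_betw[OF bij, symmetric]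
    using inj assms(2) by (intro sum.cong) (simp_all add: sign_map_permutation)
qed

text \<open>The determinant does not vanish along the segment from the identity matrix to the Gram matrix,
  because all matrices on it are positive definite.\<close>

lemma det_on_gram_pos:
  fixes f :: "'i \<Rightarrow> 'v::real_inner"
  assumes "finite B" and indep: "\<And>c. (\<Sum>b\<in>B. c b *\<^sub>R f b) = 0 \<Longrightarrow> (\<forall>b\<in>B. c b = 0)"
  shows "0 < det_on B (\<lambda>i j. inner (f i) (f j))"
proof -
  define n where "n = card B"
  obtain h where h: "bij_betw h {0..<n} B"
    using ex_bij_betw_nat_finite[OF assms(1)] n_def by blast
  define g where "g = (\<lambda>i. f (h i))"
  define A where "A t = Matrix.mat n n (\<lambda>(i, j). (1 - t) * (if i = j then 1 else 0) + t * inner (g i) (g j))"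
    for t :: real
  define D where "D t = Determinant.det (A t)" for t
  have D_eq: "D t = (\<Sum>p | p permutes {0..<n}. of_int (sign p) *
      (\<Prod>i = 0..<n. (1 - t) * (if i = p i then 1 else 0) + t * inner (g i) (g (p i))))" for t
    unfolding D_def
    by (subst det_def'[of _ n]) (auto simp: A_def permutes_in_image intro!: sum.cong prod.cong)
  have cont: "continuous_on {0..1} D"
    unfolding D_eq by (intro continuous_intros)
  have D0: "D 0 = 1"
  proof -
    have "A 0 = 1\<^sub>m n" by (auto simp: A_def)
    then show ?thesis by (simp add: D_def)
  qed
  have nz: "D t \<noteq> 0" if t: "0 \<le> t" "t \<le> 1" for t
  proof
    assume "D t = 0"
    then obtain v where v: "v \<in> carrier_vec n" "v \<noteq> 0\<^sub>v n" "A t *\<^sub>v v = 0\<^sub>v n"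
      using det_0_iff_vec_prod_zero_field[of "A t" n] by (auto simp: D_def A_def)
    define x where "x i = v $ i" for i
    have row: "(1 - t) * x i + t * (\<Sum>j<n. inner (g i) (g j) * x j) = 0" if "i < n" for i
    proof -
      have "0 = (A t *\<^sub>v v) $ i" using v(3) that by simp
      also have "\<dots> = (\<Sum>j<n. ((1 - t) * (if i = j then 1 else 0) + t * inner (g i) (g j)) * x j)"
        using that v(1) by (auto simp: A_def scalar_prod_def x_def lessThan_atLeast0 intro!: sum.cong)
      also have "\<dots> = (\<Sum>j<n. (if i = j then (1 - t) * x j else 0) + t * (inner (g i) (g j) * x j))"
        by (intro sum.cong) (auto simp: algebra_simps)
      also have "\<dots> = (1 - t) * x i + t * (\<Sum>j<n. inner (g i) (g j) * x j)"
        using that by (simp add: sum.distrib sum_distrib_left)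
      finally show ?thesis by simp
    qed
    let ?y = "\<Sum>i<n. x i *\<^sub>R g i"
    \<comment> \<open>Pairing the kernel equation with \<open>v\<close> itself yields a sum of two
      nonnegative terms: \<open>(1 - t)\<close> times the squared length of \<open>v\<close> and
      \<open>t\<close> times that of \<open>?y\<close>.\<close>
    have "0 = (\<Sum>i<n. x i * ((1 - t) * x i + t * (\<Sum>j<n. inner (g i) (g j) * x j)))"
      using row by simp
    also have "\<dots> = (1 - t) * (\<Sum>i<n. (x i)\<^sup>2) + t * (\<Sum>i<n. x i * (\<Sum>j<n. inner (g i) (g j) * x j))"
      by (simp add: distrib_left sum.distrib sum_distrib_left power2_eq_square mult_ac)
    also have "(\<Sum>i<n. x i * (\<Sum>j<n. inner (g i) (g j) * x j)) = inner ?y ?y"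
      by (simp add: inner_sum_left inner_sum_right sum_distrib_left inner_commute mult_ac)
    finally have eq: "(1 - t) * (\<Sum>i<n. (x i)\<^sup>2) + t * inner ?y ?y = 0" by simp
    moreover have "0 \<le> (1 - t) * (\<Sum>i<n. (x i)\<^sup>2)" "0 \<le> t * inner ?y ?y"
      using t by (auto intro!: mult_nonneg_nonneg sum_nonneg)
    ultimately have "(1 - t) * (\<Sum>i<n. (x i)\<^sup>2) = 0" "t * inner ?y ?y = 0" by linarith+
    \<comment> \<open>The weights \<open>1 - t\<close> and \<open>t\<close> are not both 0.\<close>
    then have "(\<Sum>i<n. (x i)\<^sup>2) = 0 \<or> ?y = 0" by auto
    then have "\<forall>i<n. x i = 0"
    proof
      assume "(\<Sum>i<n. (x i)\<^sup>2) = 0"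
      then show ?thesis by (simp add: sum_nonneg_eq_0_iff)
    next
      assume y: "?y = 0"
      define c where "c b = x (inv_into {0..<n} h b)" for b
      have "(\<Sum>b\<in>B. c b *\<^sub>R f b) = (\<Sum>i\<in>{0..<n}. c (h i) *\<^sub>R f (h i))"
        by (rule sum.reindex_bij_betw[OF h, symmetric])
      also have "\<dots> = ?y"
        using h by (auto simp: c_def g_def lessThan_atLeast0 bij_betw_inv_into_left intro!: sum.cong)
      finally have "\<forall>b\<in>B. c b = 0" using y by (intro indep) simp
      moreover have "h i \<in> B \<and> c (h i) = x i" if "i < n" for i
        using h that bij_betwE[OF h] by (auto simp: c_def bij_betw_inv_into_left)
      ultimately show ?thesis by metis
    qed
    then have "v = 0\<^sub>v n" using v(1) by (auto simp: x_def)
    then show False using v(2) by simp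
  qed
  have "0 < D 1"
  proof (rule ccontr)
    assume "\<not> 0 < D 1"
    \<comment> \<open>Intermediate values between \<open>D 0 = 1\<close> and the supposed
      \<open>D 1 \<le> 0\<close>.\<close>
    then have "\<exists>t. 0 \<le> t \<and> t \<le> 1 \<and> D t = 0"
      using D0 by (intro IVT2' cont) auto
    then show False using nz by blast
  qed
  also have "D 1 = det_on {0..<n} (\<lambda>i j. inner (f (h i)) (f (h j)))"
    by (simp add: D_eq det_on_def g_def)
  also have "\<dots> = det_on B (\<lambda>i j. inner (f i) (f j))"
    by (rule det_on_reindex[OF h finite_atLeastLessThan, symmetric])
  finally show ?thesis .
qed

text \<open>The derivative of a chart has a left inverse, so it keeps the vectors of
  \<open>B\<close> independent and their Gram determinant is positive.\<close>

lemma slice_chart_volume_density_pos: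
  assumes "slice_chart d S B W \<Phi>" "z \<in> W"
  shows "0 < volume_density B \<Phi> z"
proof -
  have B: "B \<subseteq> Basis" "finite B"
    using assms(1) finite_subset[OF _ finite_Basis] unfolding slice_chart_def by blast+
  let ?D = "frechet_derivative \<Phi> (at z)"
  have lin: "linear ?D"
    by (rule has_derivative_linear[OF smooth_on_imp_has_derivative[of W]])
      (use assms in \<open>simp_all add: slice_chart_def\<close>)
  have "\<forall>b\<in>B. c b = 0" if c: "(\<Sum>b\<in>B. c b *\<^sub>R ?D b) = 0" for c
  proof -
    have "(\<Sum>b\<in>B. c b *\<^sub>R ?D b) = ?D (\<Sum>b\<in>B. c b *\<^sub>R b)"
      by (simp add: linear_sum[OF lin] linear_scale[OF lin])
    then have "?D (\<Sum>b\<in>B. c b *\<^sub>R b) = ?D 0"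
      using c linear_0[OF lin] by simp
    then have "(\<Sum>b\<in>B. c b *\<^sub>R b) = 0"
      using slice_chart_inverse_derivative[OF assms] by metis
    then show ?thesis
      using independent_substdbasis[OF B(1)] independentD[OF _ B(2) subset_refl] by blast
  qed
  from det_on_gram_pos[OF B(2) this] show ?thesis
    by (simp add: volume_density_def)
qed

lemma slice_chart_volume_density_continuous:
  assumes "slice_chart d S B W \<Phi>"
  shows "continuous_on W (volume_density B \<Phi>)"
  using assms unfolding volume_density_def det_on_def slice_chart_def
  by (intro continuous_intros smooth_on_imp_continuous_derivative) auto

section \<open>Lebesgue measure on coordinate planes\<close>

lemma sets_plane_lborel [measurable_cong, simp]: "sets (plane_lborel B) = sets borel"
  by (simp add: plane_lborel_def)

text \<open>The set contains the image of a small open cube of coordinates around those of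
  \<open>z\<close>, whose product measure is explicit.\<close>

lemma emeasure_plane_lborel_ball_pos:
  fixes z :: "'a::euclidean_space"
  assumes B: "B \<subseteq> Basis" and z: "z \<in> span B" and e: "0 < e"
  shows "0 < emeasure (plane_lborel B) (ball z e \<inter> span B)"
proof -
  have fin: "finite B" using B finite_subset finite_Basis by blast
  interpret product_sigma_finite "\<lambda>b::'a. lborel :: real measure" ..
  let ?P = "\<Pi>\<^sub>M b\<in>B. (lborel :: real measure)" and ?g = "\<lambda>c. \<Sum>b\<in>B. c b *\<^sub>R b"
  have g: "?g \<in> borel_measurable ?P"
  proof (intro borel_measurable_sum borel_measurable_scaleR borel_measurable_const)
    fix b assume "b \<in> B"
    then show "(\<lambda>c. c b) \<in> borel_measurable ?P"
      using measurable_component_singleton[of b B "\<lambda>_. lborel :: real measure"]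
      by (simp cong: measurable_cong_sets)
  qed
  have K: "ball z e \<inter> span B \<in> sets borel"
    by (simp add: closed_span borel_closed)
  \<comment> \<open>The \<open>card B\<close> coordinate errors, each at most \<delta>, must add up
    to less than \<open>e\<close>. The summand 1 makes this strict and keeps \<delta> positive for
    empty \<open>B\<close>, where the box is a single point of mass 1.\<close>
  define \<delta> where "\<delta> = e / (real (card B) + 1)"
  have \<delta>: "0 < \<delta>" "card B * \<delta> < e"
    using e by (auto simp: \<delta>_def field_simps)
  let ?box = "\<Pi>\<^sub>E b\<in>B. {z \<bullet> b - \<delta><..<z \<bullet> b + \<delta>}"
  have zsum: "(\<Sum>b\<in>B. (z \<bullet> b) *\<^sub>R b) = z"
  proof -
    have "(\<Sum>b\<in>B. (z \<bullet> b) *\<^sub>R b) = (\<Sum>b\<in>Basis. (z \<bullet> b) *\<^sub>R b)"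
      using B z by (intro sum.mono_neutral_left) (auto simp: span_substd_basis)
    then show ?thesis by (simp add: euclidean_representation)
  qed
  have "?box \<subseteq> ?g -` (ball z e \<inter> span B) \<inter> space ?P"
  proof
    fix c assume c: "c \<in> ?box"
    have "dist z (?g c) = norm (\<Sum>b\<in>B. (z \<bullet> b - c b) *\<^sub>R b)"
      by (subst (1) zsum[symmetric]) (simp add: dist_norm sum_subtractf scaleR_diff_left)
    also have "\<dots> \<le> (\<Sum>b\<in>B. \<delta>)"
    proof (rule sum_norm_le)
      fix b assume b: "b \<in> B"
      then have "c b \<in> {z \<bullet> b - \<delta><..<z \<bullet> b + \<delta>}" "norm b = 1"
        using c B by (auto simp: PiE_iff)
      then show "norm ((z \<bullet> b - c b) *\<^sub>R b) \<le> \<delta>" by auto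
    qed
    also have "\<dots> < e" using \<delta>(2) by simp
    finally have "?g c \<in> ball z e" by simp
    moreover have "?g c \<in> span B"
      by (intro span_sum span_scale span_base)
    moreover have "c \<in> space ?P" using c by (auto simp: space_PiM PiE_iff)
    ultimately show "c \<in> ?g -` (ball z e \<inter> span B) \<inter> space ?P" by blast
  qed
  then have "emeasure ?P ?box \<le> emeasure ?P (?g -` (ball z e \<inter> span B) \<inter> space ?P)"
    by (rule emeasure_mono) (rule measurable_sets[OF g K])
  also have "\<dots> = emeasure (plane_lborel B) (ball z e \<inter> span B)"
    unfolding plane_lborel_def using g K by (rule emeasure_distr[symmetric])
  also have "emeasure ?P ?box = (\<Prod>b\<in>B. ennreal (2 * \<delta>))"
    using fin \<delta> by (subst emeasure_PiM) (auto intro!: prod.cong)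
  also have "\<dots> = ennreal ((2 * \<delta>) ^ card B)"
    using \<delta> by (simp add: ennreal_power)
  finally show ?thesis
    using \<delta> by (auto simp: ennreal_zero_less_mult_iff intro: less_le_trans[rotated])
qed

lemma riemannian_volume_emeasure:
  assumes "riemannian_volume d S \<mu>" "slice_chart d S B W \<Phi>" "A \<in> sets \<mu>" "A \<subseteq> \<Phi> ` W"
  shows "emeasure \<mu> A =
    (\<integral>\<^sup>+z. ennreal (volume_density B \<Phi> z) * indicator {z \<in> W. \<Phi> z \<in> A} z \<partial>plane_lborel B)"
  using assms(1)[unfolded riemannian_volume_def, THEN conjunct2, THEN conjunct2, rule_format, OF assms(2-4)] .

lemma riemannian_volume_sets_open:
  assumes "riemannian_volume d S \<mu>" "open X"
  shows "X \<inter> S \<in> sets \<mu>"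
proof -
  have "sets \<mu> = (\<inter>) S ` sets borel"
    using assms(1) by (simp add: riemannian_volume_def sets_restrict_space)
  moreover have "X \<in> sets borel" using assms(2) by simp
  ultimately show ?thesis by (simp add: Int_commute)
qed

text \<open>In a chart around \<open>p\<close> the density is bounded below by a positive constant
  on a small ball, and the slice of that ball has positive plane measure.\<close>

lemma riemannian_volume_open_pos:
  assumes S: "smooth_submanifold d S" and \<mu>: "riemannian_volume d S \<mu>"
    and G: "open G" "p \<in> G" "p \<in> S"
  shows "0 < emeasure \<mu> (G \<inter> S)"
proof -
  obtain B W \<Phi> where chart: "slice_chart d S B W \<Phi>" and pW: "p \<in> \<Phi> ` W"
    using S G(3) unfolding smooth_submanifold_def by blast
  note * = chart[unfolded slice_chart_def]
  obtain z where z: "z \<in> W" "z \<in> span B" "p = \<Phi> z"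
    using slice_chart_parametrized[OF chart G(3) pW] by blast
  \<comment> \<open>Any value strictly between 0 and the density at \<open>z\<close> would serve; by
    continuity the density stays above it near \<open>z\<close>.\<close>
  define c where "c = volume_density B \<Phi> z / 2"
  have c: "0 < c" "c < volume_density B \<Phi> z"
    using slice_chart_volume_density_pos[OF chart z(1)] by (auto simp: c_def)
  have "open (W \<inter> \<Phi> -` G)"
    using * G(1) by (intro continuous_open_preimage smooth_on_imp_continuous_on) auto
  moreover have "open (W \<inter> volume_density B \<Phi> -` {c<..})"
    using * by (intro continuous_open_preimage slice_chart_volume_density_continuous[OF chart]) auto
  ultimately have "open ((W \<inter> \<Phi> -` G) \<inter> (W \<inter> volume_density B \<Phi> -` {c<..}))" by (rule open_Int)
  moreover have "z \<in> (W \<inter> \<Phi> -` G) \<inter> (W \<inter> volume_density B \<Phi> -` {c<..})"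
    using z c G(2) by simp
  ultimately obtain e where e: "0 < e" "ball z e \<subseteq> (W \<inter> \<Phi> -` G) \<inter> (W \<inter> volume_density B \<Phi> -` {c<..})"
    unfolding open_contains_ball by blast
  \<comment> \<open>The intersection with the chart image makes the volume formula
    applicable.\<close>
  let ?A = "G \<inter> \<Phi> ` W \<inter> S" and ?K = "ball z e \<inter> span B"
  have "open (G \<inter> \<Phi> ` W)" using G(1) * by (intro open_Int) simp_all
  note A = riemannian_volume_sets_open[OF \<mu> this] riemannian_volume_sets_open[OF \<mu> G(1)]
  have K: "?K \<in> sets (plane_lborel B)"
    by (simp add: closed_span borel_closed)
  have "0 < ennreal c * emeasure (plane_lborel B) ?K"
    using c * emeasure_plane_lborel_ball_pos[OF _ z(2) e(1)] by (simp add: ennreal_zero_less_mult_iff)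
  also have "\<dots> = (\<integral>\<^sup>+w. ennreal c * indicator ?K w \<partial>plane_lborel B)"
    using K by (rule nn_integral_cmult_indicator[symmetric])
  also have "\<dots> \<le> (\<integral>\<^sup>+w. ennreal (volume_density B \<Phi> w) * indicator {w \<in> W. \<Phi> w \<in> ?A} w \<partial>plane_lborel B)"
  proof (rule nn_integral_mono)
    fix w
    show "ennreal c * indicator ?K w \<le> ennreal (volume_density B \<Phi> w) * indicator {w \<in> W. \<Phi> w \<in> ?A} w"
    proof (cases "w \<in> ?K")
      case True
      then have w: "w \<in> W" "\<Phi> w \<in> G" "c < volume_density B \<Phi> w" "w \<in> span B"
        using e(2) by auto
      then have "\<Phi> w \<in> S" using * by blast
      with w show ?thesis
        using True by (auto intro!: ennreal_leI)
    qed simp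
  qed
  also have "\<dots> = emeasure \<mu> ?A"
    by (rule riemannian_volume_emeasure[OF \<mu> chart A(1), symmetric]) blast
  also have "\<dots> \<le> emeasure \<mu> (G \<inter> S)"
    using A(2) by (intro emeasure_mono) auto
  finally show ?thesis .
qed

section \<open>Invariance of the Riemannian volume\<close>

text \<open>Cut \<open>A\<close> along the disjointed cover: each piece lies in one member, where
  the measures agree, and countable additivity sums the pieces. It extends equalities verified
  inside single charts to all measurable sets.\<close>

lemma measure_eqI_countable_cover:
  assumes sets: "sets M = sets N" and F: "countable F" "F \<subseteq> sets M" "space M \<subseteq> \<Union>F"
    and eq: "\<And>A X. X \<in> F \<Longrightarrow> A \<in> sets M \<Longrightarrow> A \<subseteq> X \<Longrightarrow> emeasure M A = emeasure N A"
  shows "M = N"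
proof (rule measure_eqI[OF sets])
  fix A assume A: "A \<in> sets M"
  show "emeasure M A = emeasure N A"
  proof (cases "F = {}")
    case True
    then have "A = {}" using F(3) sets.sets_into_space[OF A] by auto
    then show ?thesis by simp
  next
    case False
    define X where "X = from_nat_into F"
    have X: "range X = F" using False F(1) by (simp add: X_def range_from_nat_into)
    define E where "E n = A \<inter> disjointed X n" for n
    have E: "E n \<in> sets M" for n
    proof -
      have "range X \<subseteq> sets M" using X F(2) by simp
      then have "disjointed X n \<in> sets M" using sets.range_disjointed_sets[of X M] by auto
      then show ?thesis using A by (simp add: E_def sets.Int)
    qed
    have disj: "disjoint_family E"
      using disjoint_family_disjointed[of X] by (auto simp: disjoint_family_on_def E_def)
    have UN: "(\<Union>n. E n) = A"
      using X F(3) sets.sets_into_space[OF A] by (auto simp: E_def UN_disjointed_eq[of X] simp flip: Int_UN_distrib)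
    have "emeasure M A = (\<Sum>n. emeasure M (E n))"
      unfolding UN[symmetric] using E disj by (intro suminf_emeasure[symmetric]) auto
    also have "\<dots> = (\<Sum>n. emeasure N (E n))"
      using X E disjointed_subset[of X] by (intro arg_cong[of _ _ suminf] ext eq) (auto simp: E_def)
    also have "\<dots> = emeasure N A"
      unfolding UN[symmetric] using E disj sets by (intro suminf_emeasure) auto
    finally show ?thesis .
  qed
qed

context coordinate_involution
begin

lemma riemannian_volume_measurable:
  assumes "riemannian_volume d S \<mu>" "\<sigma> ` S = S"
  shows "\<sigma> \<in> measurable \<mu> \<mu>"
proof -
  have sets: "sets \<mu> = sets (restrict_space borel S)"
    using assms(1) by (simp add: riemannian_volume_def)
  have "\<sigma> \<in> borel_measurable borel"
    by (intro borel_measurable_continuous_onI linear_continuous_on bounded_linear)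
  then have "\<sigma> \<in> measurable (restrict_space borel S) (restrict_space borel S)"
    using assms(2) by (intro measurable_restrict_space3) auto
  then show ?thesis
    by (simp add: measurable_cong_sets[OF sets sets])
qed

lemma distr_riemannian_volume:
  assumes S: "smooth_submanifold d S" and \<mu>: "riemannian_volume d S \<mu>" and inv: "\<sigma> ` S = S"
  shows "distr \<mu> \<mu> \<sigma> = \<mu>"
proof -
  have space: "space \<mu> = S"
    using \<mu> unfolding riemannian_volume_def by simp
  have meas: "\<sigma> \<in> measurable \<mu> \<mu>"
    using \<mu> inv by (rule riemannian_volume_measurable)
  define G where "G = {\<Phi> ` W | B W \<Phi>. slice_chart d S B W \<Phi>}"
  have open_G: "open X" if "X \<in> G" for X
    using that by (auto simp: G_def slice_chart_def)
  obtain F where F: "F \<subseteq> G" "countable F" "\<Union>F = \<Union>G"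
    by (rule Lindelof[OF open_G])
  have cover: "S \<subseteq> \<Union>F"
  proof
    fix p assume "p \<in> S"
    then obtain B W \<Phi> where chart: "slice_chart d S B W \<Phi>" and p: "p \<in> \<Phi> ` W"
      using S by (auto simp: smooth_submanifold_def)
    from chart have "\<Phi> ` W \<in> G" unfolding G_def by auto
    with p show "p \<in> \<Union>F" unfolding F(3) by (rule UnionI[rotated])
  qed
  have open_F: "open X" if "X \<in> F" for X
    using that F(1) open_G by auto
  show ?thesis
  proof (rule measure_eqI_countable_cover[where F = "(\<lambda>X. X \<inter> S) ` F"])
    show "countable ((\<lambda>X. X \<inter> S) ` F)" using F(2) by simp
    show "(\<lambda>X. X \<inter> S) ` F \<subseteq> sets (distr \<mu> \<mu> \<sigma>)"
      using riemannian_volume_sets_open[OF \<mu> open_F] by (simp add: image_subset_iff)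
    show "space (distr \<mu> \<mu> \<sigma>) \<subseteq> \<Union>((\<lambda>X. X \<inter> S) ` F)"
      using cover by (auto simp: space)
  next
    fix A Y assume "Y \<in> (\<lambda>X. X \<inter> S) ` F" and A: "A \<in> sets (distr \<mu> \<mu> \<sigma>)" "A \<subseteq> Y"
    then obtain B W \<Phi> where chart: "slice_chart d S B W \<Phi>" and AW: "A \<subseteq> \<Phi> ` W"
      using F(1) unfolding G_def by blast
    have A': "A \<in> sets \<mu>" using A by simp
    have AS: "A \<subseteq> S" using sets.sets_into_space[OF A'] space by simp
    have \<sigma>A: "\<sigma> -` A \<inter> space \<mu> = \<sigma> ` A"
      using AS inv by (auto simp: space image_eq_vimage[symmetric])
    have "emeasure (distr \<mu> \<mu> \<sigma>) A = emeasure \<mu> (\<sigma> ` A)"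
      using meas A' by (simp add: emeasure_distr \<sigma>A)
    also have "\<dots> = (\<integral>\<^sup>+z. ennreal (volume_density B (\<lambda>z. \<sigma> (\<Phi> z)) z) *
        indicator {z \<in> W. \<sigma> (\<Phi> z) \<in> \<sigma> ` A} z \<partial>plane_lborel B)"
    proof (rule riemannian_volume_emeasure[OF \<mu> slice_chart_comp[OF chart inv]])
      show "\<sigma> ` A \<in> sets \<mu>" using measurable_sets[OF meas A'] by (simp add: \<sigma>A)
      show "\<sigma> ` A \<subseteq> (\<lambda>z. \<sigma> (\<Phi> z)) ` W" using AW by blast
    qed
    also have "\<dots> = (\<integral>\<^sup>+z. ennreal (volume_density B \<Phi> z) * indicator {z \<in> W. \<Phi> z \<in> A} z \<partial>plane_lborel B)"
    proof (rule nn_integral_cong)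
      fix z
      \<comment> \<open>Off \<open>W\<close> both indicators vanish, so the densities are compared
        only where \<Phi> is differentiable.\<close>
      have "volume_density B (\<lambda>z. \<sigma> (\<Phi> z)) z = volume_density B \<Phi> z" if "z \<in> W"
        using chart that unfolding slice_chart_def
        by (intro volume_density_comp smooth_on_imp_differentiable[of W]) auto
      then show "ennreal (volume_density B (\<lambda>z. \<sigma> (\<Phi> z)) z) * indicator {z \<in> W. \<sigma> (\<Phi> z) \<in> \<sigma> ` A} z =
          ennreal (volume_density B \<Phi> z) * indicator {z \<in> W. \<Phi> z \<in> A} z"
        by (auto simp: mem_image_iff indicator_def)
    qed
    also have "\<dots> = emeasure \<mu> A"
      by (rule riemannian_volume_emeasure[OF \<mu> chart A' AW, symmetric])
    finally show "emeasure (distr \<mu> \<mu> \<sigma>) A = emeasure \<mu> A" .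
  qed simp
qed

end

section \<open>Invariance of the minimization problem\<close>

text \<open>The converse is the forward direction applied to \<open>f \<circ> \<sigma>\<close>. It
  allows the change of variables to be stated for arbitrary integrands.\<close>

lemma (in coordinate_involution) borel_measurable_comp_iff:
  fixes f :: "'a \<Rightarrow> 'b::topological_space"
  assumes "\<sigma> \<in> measurable \<mu> \<mu>"
  shows "(\<lambda>p. f (\<sigma> p)) \<in> borel_measurable \<mu> \<longleftrightarrow> f \<in> borel_measurable \<mu>"
proof
  show "(\<lambda>p. f (\<sigma> p)) \<in> borel_measurable \<mu>" if "f \<in> borel_measurable \<mu>" for f :: "'a \<Rightarrow> 'b"
    using measurable_compose[OF assms that] .
  from this[of "\<lambda>p. f (\<sigma> p)"]
  show "f \<in> borel_measurable \<mu>" if "(\<lambda>p. f (\<sigma> p)) \<in> borel_measurable \<mu>"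
    using that by simp
qed

locale symmetric_riemannian_volume = coordinate_involution \<sigma>
  for \<sigma> :: "'a::euclidean_space \<Rightarrow> 'a" +
  fixes d S \<mu>
  assumes submanifold: "smooth_submanifold d S"
    and volume: "riemannian_volume d S \<mu>"
    and invariant: "\<sigma> ` S = S"
begin

lemma space_eq: "space \<mu> = S"
  using volume unfolding riemannian_volume_def by simp

lemma measurable: "\<sigma> \<in> measurable \<mu> \<mu>"
  using volume invariant by (rule riemannian_volume_measurable)

lemma distr: "distr \<mu> \<mu> \<sigma> = \<mu>"
  using submanifold volume invariant by (rule distr_riemannian_volume)

lemma AE_comp: "AE p in \<mu>. P p \<Longrightarrow> AE p in \<mu>. P (\<sigma> p)"
  by (rule AE_distrD[OF measurable, unfolded distr])

lemma integrable_comp: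
  fixes f :: "'a \<Rightarrow> 'b::{banach, second_countable_topology}"
  assumes "integrable \<mu> f"
  shows "integrable \<mu> (\<lambda>p. f (\<sigma> p))"
  using integrable_distr[OF measurable, of f] assms by (simp add: distr)

text \<open>For non-measurable \<open>f\<close> both sides have the default value 0. Hence integrals
  in \<open>weak_gradient\<close> and \<open>objective\<close> can be transformed without separate
  integrability proofs.\<close>

lemma integral_comp:
  fixes f :: "'a \<Rightarrow> 'b::{banach, second_countable_topology}"
  shows "(\<integral>p. f (\<sigma> p) \<partial>\<mu>) = (\<integral>p. f p \<partial>\<mu>)"
proof (cases "f \<in> borel_measurable \<mu>")
  case True
  then show ?thesis
    using integral_distr[OF measurable, of f] by (simp add: distr)
next
  case False
  then have "\<not> integrable \<mu> f" "\<not> integrable \<mu> (\<lambda>p. f (\<sigma> p))"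
    using borel_measurable_comp_iff[OF measurable, of f] borel_measurable_integrable by blast+
  then show ?thesis
    by (simp add: not_integrable_integral_eq)
qed

lemma square_integrable_comp:
  fixes f :: "'a \<Rightarrow> 'b::euclidean_space"
  assumes "square_integrable \<mu> f"
  shows "square_integrable \<mu> (\<lambda>p. f (\<sigma> p))"
  using assms integrable_comp[of "\<lambda>p. (norm (f p))\<^sup>2"]
  by (simp add: square_integrable_def borel_measurable_comp_iff[OF measurable])

lemma square_integrable_image:
  assumes "square_integrable \<mu> f"
  shows "square_integrable \<mu> (\<lambda>p. \<sigma> (f p))"
proof -
  have "\<sigma> \<in> borel_measurable borel"
    by (intro borel_measurable_continuous_onI linear_continuous_on bounded_linear)
  then show ?thesis
    using assms measurable_compose[of f \<mu> borel \<sigma> borel] by (simp add: square_integrable_def)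
qed

text \<open>Testing the transformed gradient with \<open>X\<close> amounts to testing the original
  one with the push-forward of \<open>X\<close>; the change of variables is made once on each side
  of the identity.\<close>

lemma weak_gradient_comp:
  assumes "weak_gradient S \<mu> U F"
  shows "weak_gradient S \<mu> (\<lambda>p. U (\<sigma> p)) (\<lambda>p. \<sigma> (F (\<sigma> p)))"
  unfolding weak_gradient_def
proof (intro conjI allI impI)
  have "AE p in \<mu>. F (\<sigma> p) \<in> tangent_space S (\<sigma> p)"
    using assms unfolding weak_gradient_def by (intro AE_comp) simp
  then show "AE p in \<mu>. \<sigma> (F (\<sigma> p)) \<in> tangent_space S p"
    by (simp add: tangent_space_image[OF invariant] mem_image_iff)
next
  fix X assume X: "smooth_tangent_field S X"
  let ?Y = "\<lambda>p. \<sigma> (X (\<sigma> p))"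
  have Y: "smooth_tangent_field S ?Y"
    using invariant X by (rule smooth_tangent_field_conj)
  have "(\<integral>p. \<sigma> (F (\<sigma> p)) \<bullet> X p \<partial>\<mu>) = (\<integral>p. F (\<sigma> p) \<bullet> ?Y (\<sigma> p) \<partial>\<mu>)"
    by (simp add: inner_swap)
  also have "\<dots> = (\<integral>p. F p \<bullet> ?Y p \<partial>\<mu>)"
    by (rule integral_comp)
  also have "\<dots> = - (\<integral>p. U p * surface_divergence S ?Y p \<partial>\<mu>)"
    using assms Y unfolding weak_gradient_def by simp
  \<comment> \<open>The divergence identity is available on \<open>S\<close>, which is the whole
    space of \<mu>.\<close>
  also have "(\<integral>p. U p * surface_divergence S ?Y p \<partial>\<mu>) = (\<integral>p. U p * surface_divergence S X (\<sigma> p) \<partial>\<mu>)"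
    by (intro Bochner_Integration.integral_cong refl)
      (simp add: space_eq surface_divergence_conj[OF invariant submanifold X])
  also have "\<dots> = (\<integral>p. U (\<sigma> p) * surface_divergence S X p \<partial>\<mu>)"
    using integral_comp[of "\<lambda>p. U p * surface_divergence S X (\<sigma> p)"] by simp
  finally show "(\<integral>p. \<sigma> (F (\<sigma> p)) \<bullet> X p \<partial>\<mu>) = - (\<integral>p. U (\<sigma> p) * surface_divergence S X p \<partial>\<mu>)" .
qed

lemma sobolev12_comp:
  assumes "sobolev12 S \<mu> U F"
  shows "sobolev12 S \<mu> (\<lambda>p. U (\<sigma> p)) (\<lambda>p. \<sigma> (F (\<sigma> p)))"
  using assms unfolding sobolev12_def
  by (auto intro: square_integrable_comp square_integrable_image weak_gradient_comp)

lemma continuous_representative_comp: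
  assumes "continuous_representative S \<mu> U V"
  shows "continuous_representative S \<mu> (\<lambda>p. U (\<sigma> p)) (\<lambda>p. V (\<sigma> p))"
proof -
  have "continuous_on S (\<lambda>p. V (\<sigma> p))"
    using assms invariant linear_continuous_on[OF bounded_linear, of S]
    by (intro continuous_on_compose2[of S V S \<sigma>]) (simp_all add: continuous_representative_def)
  then show ?thesis
    using assms AE_comp[of "\<lambda>p. V p = U p"] unfolding continuous_representative_def by simp
qed

end

text \<open>If the values at \<open>p\<close> differ, Hausdorff separation gives a relatively open
  neighbourhood of \<open>p\<close> on which the functions differ; it would be null and of positive
  volume.\<close>

lemma continuous_on_AE_eq:
  fixes V W :: "'a::euclidean_space \<Rightarrow> 'b::t2_space"
  assumes S: "smooth_submanifold d S" and \<mu>: "riemannian_volume d S \<mu>"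
    and V: "continuous_on S V" and W: "continuous_on S W"
    and eq: "AE p in \<mu>. V p = W p" and p: "p \<in> S"
  shows "V p = W p"
proof (rule ccontr)
  assume "V p \<noteq> W p"
  then obtain A B where AB: "open A" "open B" "V p \<in> A" "W p \<in> B" "A \<inter> B = {}"
    by (meson hausdorff)
  obtain X where X: "open X" "X \<inter> S = V -` A \<inter> S"
    using V AB(1) by (auto simp: continuous_on_open_invariant)
  obtain Y where Y: "open Y" "Y \<inter> S = W -` B \<inter> S"
    using W AB(2) by (auto simp: continuous_on_open_invariant)
  have "p \<in> X \<inter> Y" using X(2) Y(2) p AB(3,4) by blast
  then have pos: "0 < emeasure \<mu> ((X \<inter> Y) \<inter> S)"
    using X(1) Y(1) p by (intro riemannian_volume_open_pos[OF S \<mu>]) auto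
  have ne: "V q \<noteq> W q" if "q \<in> (X \<inter> Y) \<inter> S" for q
  proof -
    have "q \<in> V -` A \<inter> S" "q \<in> W -` B \<inter> S"
      unfolding X(2)[symmetric] Y(2)[symmetric] using that by simp_all
    then show ?thesis using AB(5) by (metis IntD1 disjoint_iff vimageD)
  qed
  from eq have "AE q in \<mu>. q \<notin> (X \<inter> Y) \<inter> S"
    by eventually_elim (use ne in blast)
  then have "(X \<inter> Y) \<inter> S \<in> null_sets \<mu>"
    using riemannian_volume_sets_open[OF \<mu> open_Int[OF X(1) Y(1)]] by (simp only: AE_iff_null_sets)
  with pos show False by (simp add: null_setsD1)
qed

section \<open>The exchange of the two factors\<close>

interpretation swap: coordinate_involution "prod.swap :: 'a::euclidean_space \<times> 'a \<Rightarrow> 'a \<times> 'a"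
proof
  have "linear (prod.swap :: 'a \<times> 'a \<Rightarrow> 'a \<times> 'a)"
    by (auto simp: linear_iff prod_eq_iff)
  then show "orthogonal_transformation (prod.swap :: 'a \<times> 'a \<Rightarrow> 'a \<times> 'a)"
    by (simp add: orthogonal_transformation_def inner_prod_def)
  show "prod.swap ` Basis = (Basis :: ('a \<times> 'a) set)"
    by (auto simp: Basis_prod_def image_Un image_image)
qed simp

text \<open>As an element of a Sobolev space \<open>U\<close> is fixed only up to null sets, so
  pointwise symmetry is claimed for its continuous representative.\<close>

theorem theorem6p2:
  fixes M :: "(real ^ 'n) set" and d :: nat and \<alpha> :: real
    and \<mu> :: "((real ^ 'n) \<times> (real ^ 'n)) measure"
    and U :: "(real ^ 'n) \<times> (real ^ 'n) \<Rightarrow> real"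
  assumes "compact M" and "smooth_submanifold d M"
    and "riemannian_volume (2 * d) (M \<times> M) \<mu>"
    and "\<alpha> > 0"
    and "unique_minimizer \<alpha> M \<mu> U"
  shows "(AE (x, y) in \<mu>. U (x, y) = U (y, x)) \<and>
    (\<forall>V. continuous_representative (M \<times> M) \<mu> U V \<longrightarrow>
       (\<forall>x\<in>M. \<forall>y\<in>M. V (x, y) = V (y, x)))"
proof -
  interpret symmetric_riemannian_volume prod.swap "2 * d" "M \<times> M" \<mu>
  proof
    show "smooth_submanifold (2 * d) (M \<times> M)"
      using smooth_submanifold_Times[OF assms(2,2)] by (simp add: mult_2)
    show "prod.swap ` (M \<times> M) = M \<times> M" by (rule product_swap)
  qed (rule assms)
  let ?\<sigma> = "prod.swap :: (real ^ 'n) \<times> (real ^ 'n) \<Rightarrow> _"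
  have feasible: "feasible M \<mu> (\<lambda>p. V (?\<sigma> p)) (\<lambda>p. ?\<sigma> (F (?\<sigma> p)))" if V: "feasible M \<mu> V F" for V F
    unfolding feasible_def
  proof (intro conjI)
    show "sobolev12 (M \<times> M) \<mu> (\<lambda>p. V (?\<sigma> p)) (\<lambda>p. ?\<sigma> (F (?\<sigma> p)))"
      using V unfolding feasible_def by (intro sobolev12_comp) simp
    have "AE p in \<mu>. fst p \<noteq> snd p \<longrightarrow> norm (fst (F p)) \<le> 1" "AE p in \<mu>. fst p \<noteq> snd p \<longrightarrow> norm (snd (F p)) \<le> 1"
      using V unfolding feasible_def by (simp_all add: case_prod_unfold)
    \<comment> \<open>The bound on either component of the transformed gradient comes from the bound
      on the other component at the exchanged point.\<close>
    from this[THEN AE_comp]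
    show "AE (x, y) in \<mu>. x \<noteq> y \<longrightarrow> norm (fst (?\<sigma> (F (?\<sigma> (x, y))))) \<le> 1"
      "AE (x, y) in \<mu>. x \<noteq> y \<longrightarrow> norm (snd (?\<sigma> (F (?\<sigma> (x, y))))) \<le> 1"
      by (simp_all add: case_prod_unfold prod.swap_def eq_commute)
    obtain R where "continuous_representative (M \<times> M) \<mu> V R" "\<And>x. x \<in> M \<Longrightarrow> R (x, x) \<le> 0"
      using V unfolding feasible_def by auto
    \<comment> \<open>The exchange fixes every point of the diagonal, so the composed representative
      has the same values there.\<close>
    then show "\<exists>R. continuous_representative (M \<times> M) \<mu> (\<lambda>p. V (?\<sigma> p)) R \<and> (\<forall>x\<in>M. R (x, x) \<le> 0)"
      by (intro exI[of _ "\<lambda>p. R (?\<sigma> p)"]) (simp add: continuous_representative_comp)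
  qed
  have objective: "objective \<alpha> \<mu> (\<lambda>p. V (?\<sigma> p)) (\<lambda>p. ?\<sigma> (F (?\<sigma> p))) = objective \<alpha> \<mu> V F" for V F
    using integral_comp[of V] integral_comp[of "\<lambda>p. (norm (fst (F p)))\<^sup>2 + (norm (snd (F p)))\<^sup>2"]
    by (simp add: objective_def case_prod_unfold prod.swap_def add.commute)
  obtain F where F: "feasible M \<mu> U F" "\<And>V G. feasible M \<mu> V G \<Longrightarrow> objective \<alpha> \<mu> U F \<le> objective \<alpha> \<mu> V G"
    using assms(5) unfolding unique_minimizer_def minimizer_def by auto
  have "minimizer \<alpha> M \<mu> (\<lambda>p. U (?\<sigma> p))"
    unfolding minimizer_def using feasible[OF F(1)] F(2) by (intro exI conjI) (auto simp: objective)
  then have swap: "AE p in \<mu>. U (?\<sigma> p) = U p"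
    using assms(5) unfolding unique_minimizer_def by auto
  have "V (x, y) = V (y, x)" if V: "continuous_representative (M \<times> M) \<mu> U V" and xy: "x \<in> M" "y \<in> M" for V x y
  proof -
    have V': "continuous_representative (M \<times> M) \<mu> (\<lambda>p. U (?\<sigma> p)) (\<lambda>p. V (?\<sigma> p))"
      using V by (rule continuous_representative_comp)
    have cont: "continuous_on (M \<times> M) V" "continuous_on (M \<times> M) (\<lambda>p. V (?\<sigma> p))"
      and eq: "AE p in \<mu>. V p = U p" "AE p in \<mu>. V (?\<sigma> p) = U (?\<sigma> p)"
      using V V' unfolding continuous_representative_def by simp_all
    \<comment> \<open>Three almost everywhere equalities are chained: from \<open>V\<close> to
      \<open>U\<close>, to \<open>U \<circ> \<sigma>\<close>, to
      \<open>V \<circ> \<sigma>\<close>.\<close>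
    from eq swap have "AE p in \<mu>. V p = V (?\<sigma> p)" by eventually_elim simp
    from continuous_on_AE_eq[OF submanifold volume cont this, of "(x, y)"] xy show ?thesis by simp
  qed
  moreover have "AE (x, y) in \<mu>. U (x, y) = U (y, x)"
    using swap by (simp add: case_prod_unfold prod.swap_def eq_commute)
  ultimately show ?thesis by blast
qed

end
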